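(* For every positive integer $t$, there is a hereditary weakly sparse class $\mathcal C'_t$ of finite triangle-free graphs of unbounded treewidth such that for every finite triangle-free graph $H$ of treewidth at most $t$, the subclass $\{G \in \mathcal C'_t : G \text{ is } H\text{-free}\}$ has bounded treewidth.
   Context: A graph $G$ is $H$-free if $H$ is not isomorphic to an induced subgraph of $G$. A class is hereditary if it is closed under taking induced subgraphs. A class is weakly sparse if there is a finite integer $s$ such that no graph of the class contains $K_{s,s}$ as a subgraph. A graph is triangle-free if it contains no $K_3$ as a subgraph. *)

theory Defs
  imports Main
begin

record 'a sgraph =
  verts :: "'a set"
  edges :: "'a set set"

definition wf_graph :: "'a sgraph \<Rightarrow> bool" where
  "wf_graph G \<longleftrightarrow> finite (verts G) \<and>
     (\<forall>e\<in>edges G. \<exists>u v. e = {u, v} \<and> u \<noteq> v \<and> u \<in> verts G \<and> v \<in> verts G)"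

definition adj :: "'a sgraph \<Rightarrow> 'a \<Rightarrow> 'a \<Rightarrow> bool" where
  "adj G u v \<longleftrightarrow> {u, v} \<in> edges G"

definition induced :: "'a sgraph \<Rightarrow> 'a set \<Rightarrow> 'a sgraph" where
  "induced G S = \<lparr>verts = verts G \<inter> S, edges = {e\<in>edges G. e \<subseteq> S}\<rparr>"

definition graph_iso :: "'a sgraph \<Rightarrow> 'b sgraph \<Rightarrow> bool" where
  "graph_iso G H \<longleftrightarrow> (\<exists>f. bij_betw f (verts G) (verts H) \<and>
     (\<forall>u\<in>verts G. \<forall>v\<in>verts G. adj G u v \<longleftrightarrow> adj H (f u) (f v)))"

definition H_free :: "'b sgraph \<Rightarrow> 'a sgraph \<Rightarrow> bool" where
  "H_free H G \<longleftrightarrow> \<not> (\<exists>S \<subseteq> verts G. graph_iso H (induced G S))"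

definition triangle_free :: "'a sgraph \<Rightarrow> bool" where
  "triangle_free G \<longleftrightarrow> \<not> (\<exists>u\<in>verts G. \<exists>v\<in>verts G. \<exists>w\<in>verts G.
      adj G u v \<and> adj G v w \<and> adj G u w)"

definition has_Kss :: "nat \<Rightarrow> 'a sgraph \<Rightarrow> bool" where
  "has_Kss s G \<longleftrightarrow> (\<exists>A B. A \<subseteq> verts G \<and> B \<subseteq> verts G \<and> A \<inter> B = {} \<and>
      card A = s \<and> card B = s \<and> finite A \<and> finite B \<and> (\<forall>a\<in>A. \<forall>b\<in>B. adj G a b))"

definition connected_on :: "'a sgraph \<Rightarrow> 'a set \<Rightarrow> bool" where
  "connected_on G S \<longleftrightarrow> (\<forall>u\<in>S. \<forall>v\<in>S.
      (\<lambda>x y. x \<in> S \<and> y \<in> S \<and> adj G x y)\<^sup>*\<^sup>* u v)"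

definition is_tree :: "'a sgraph \<Rightarrow> bool" where
  "is_tree T \<longleftrightarrow> wf_graph T \<and> verts T \<noteq> {} \<and> connected_on T (verts T) \<and>
     card (edges T) + 1 = card (verts T)"

definition tree_decomposition :: "'a sgraph \<Rightarrow> nat sgraph \<Rightarrow> (nat \<Rightarrow> 'a set) \<Rightarrow> bool" where
  "tree_decomposition G T bag \<longleftrightarrow> is_tree T \<and>
     (\<forall>t\<in>verts T. bag t \<subseteq> verts G) \<and>
     (\<forall>v\<in>verts G. \<exists>t\<in>verts T. v \<in> bag t) \<and>
     (\<forall>u\<in>verts G. \<forall>v\<in>verts G. adj G u v \<longrightarrow> (\<exists>t\<in>verts T. u \<in> bag t \<and> v \<in> bag t)) \<and>
     (\<forall>v\<in>verts G. connected_on T {t\<in>verts T. v \<in> bag t})"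

definition treewidth_le :: "'a sgraph \<Rightarrow> nat \<Rightarrow> bool" where
  "treewidth_le G k \<longleftrightarrow> (\<exists>T bag. tree_decomposition G T bag \<and>
      (\<forall>t\<in>verts T. card (bag t) \<le> k + 1))"

definition bounded_tw :: "'a sgraph set \<Rightarrow> bool" where
  "bounded_tw C \<longleftrightarrow> (\<exists>k. \<forall>G\<in>C. treewidth_le G k)"

text \<open>Graph classes: sets of finite graphs (on nat vertices) closed under isomorphism.
  Hereditary: closed under taking induced subgraphs.\<close>
definition iso_closed :: "nat sgraph set \<Rightarrow> bool" where
  "iso_closed C \<longleftrightarrow> (\<forall>G\<in>C. \<forall>G'. wf_graph G' \<and> graph_iso G G' \<longrightarrow> G' \<in> C)"

definition hereditary :: "nat sgraph set \<Rightarrow> bool" where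
  "hereditary C \<longleftrightarrow> (\<forall>G\<in>C. \<forall>S \<subseteq> verts G. induced G S \<in> C)"

definition weakly_sparse :: "nat sgraph set \<Rightarrow> bool" where
  "weakly_sparse C \<longleftrightarrow> (\<exists>s. \<forall>G\<in>C. \<not> has_Kss s G)"

end

(* The class consists of the finite induced subgraphs of an infinite layered graph. Its layers are
   two-way infinite paths; every node has a bounded number of children, consecutive in the next layer,
   and remembers at most t + 2 of its ancestors, a child choosing which one is forgotten and to which
   of the remembered ones it is joined. Contracting layers gives large clique minors. Let P be a finite
   set of nodes. If from some node every descending path meets P often, then every triangle-free graph
   of treewidth at most t embeds into P along its tree decomposition: repeating the code of the wanted
   neighbourhood generation after generation must eventually hit P. Otherwise every node starts a
   descending path that meets P boundedly often. Such paths cut the layers into gaps of bounded size,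
   and these gaps form a tree decomposition of P of bounded width. *)

theory Submission
  imports Defs
begin

section \<open>Trees\<close>

text \<open>Two demands compete. Bounded treewidth asks that a node see few ancestors, while an
  induced copy of H asks that the neighbourhood of each new vertex be prescribed exactly within the
  current bag. The memory serves both: a bag has at most t + 1 vertices, so one of t + 2 slots can
  always be given up without losing a vertex of the bag, and every pair of an overwritten slot and a
  set of slots occurs among the children of every node. The dichotomy is a game:
  \<open>thick\<close> counts the visits to P that an opponent choosing the path cannot avoid, and
  each introduced vertex and each branching of the decomposition costs at most one unit of it.
  Triangles are prevented by letting a node whose candidates are not independent drop all its upward
  edges; the embedding never asks for such candidates, because H is triangle-free. Odd children,
  which have no upward edges, exclude triangles with two nodes in one layer and leave room to
  continue different branches below nonadjacent children.\<close>

lemma adj_commute: "adj G u v \<longleftrightarrow> adj G v u"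
  by (simp add: adj_def insert_commute)

lemma wf_graph_edgeE:
  assumes "wf_graph G" "e \<in> edges G"
  obtains u v where "e = {u, v}" "u \<noteq> v" "u \<in> verts G" "v \<in> verts G"
proof -
  have "\<exists>u v. e = {u, v} \<and> u \<noteq> v \<and> u \<in> verts G \<and> v \<in> verts G"
    using assms unfolding wf_graph_def by (elim conjE bspec)
  then show thesis using that by blast
qed

lemma wf_graph_adjD:
  assumes "wf_graph G" "adj G u v"
  shows "u \<in> verts G" "v \<in> verts G" "u \<noteq> v"
proof -
  obtain a b where "{u, v} = {a, b}" "a \<noteq> b" "a \<in> verts G" "b \<in> verts G"
    using wf_graph_edgeE[OF assms(1), of "{u, v}"] assms(2) unfolding adj_def by metis
  then show "u \<in> verts G" "v \<in> verts G" "u \<noteq> v" by (auto simp: doubleton_eq_iff)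
qed

lemma wf_graph_finite_edges: "wf_graph G \<Longrightarrow> finite (edges G)"
  by (rule finite_subset[of _ "Pow (verts G)"]) (auto simp: wf_graph_def)

definition remove_leaf :: "'a sgraph \<Rightarrow> 'a \<Rightarrow> 'a \<Rightarrow> 'a sgraph" where
  "remove_leaf T l p = \<lparr>verts = verts T - {l}, edges = edges T - {{l, p}}\<rparr>"

definition leaf :: "'a sgraph \<Rightarrow> 'a \<Rightarrow> 'a \<Rightarrow> bool" where
  "leaf T l p \<longleftrightarrow> l \<in> verts T \<and> p \<in> verts T \<and> l \<noteq> p \<and> {e \<in> edges T. l \<in> e} = {{l, p}}"

lemma leafD:
  assumes "leaf T l p"
  shows "l \<in> verts T" "p \<in> verts T" "l \<noteq> p" "{l, p} \<in> edges T"
    and "e \<in> edges T \<Longrightarrow> l \<in> e \<longleftrightarrow> e = {l, p}"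
proof -
  have "e \<in> {e \<in> edges T. l \<in> e} \<longleftrightarrow> e = {l, p}" for e
    using assms unfolding leaf_def by (metis singleton_iff)
  then show "{l, p} \<in> edges T" "e \<in> edges T \<Longrightarrow> l \<in> e \<longleftrightarrow> e = {l, p}" by blast+
qed (use assms in \<open>simp_all add: leaf_def\<close>)

lemma verts_remove_leaf [simp]: "verts (remove_leaf T l p) = verts T - {l}"
  by (simp add: remove_leaf_def)

lemma leaf_adj:
  assumes "leaf T l p"
  shows "adj T l x \<longleftrightarrow> x = p"
proof -
  have "{l, x} \<in> edges T \<longleftrightarrow> {l, x} = {l, p}"
    using leafD(4)[OF assms] leafD(5)[OF assms, of "{l, x}"] by auto
  also have "\<dots> \<longleftrightarrow> x = p" by (auto simp: doubleton_eq_iff)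
  finally show ?thesis by (simp add: adj_def)
qed

lemma adj_remove_leaf:
  assumes "leaf T l p"
  shows "adj (remove_leaf T l p) x y \<longleftrightarrow> adj T x y \<and> x \<noteq> l \<and> y \<noteq> l"
proof -
  have "e = {l, p} \<longleftrightarrow> l \<in> e" if "e \<in> edges T" for e
    using leafD(5)[OF assms that] by simp
  then show ?thesis by (auto simp: adj_def remove_leaf_def)
qed

text \<open>The degrees sum to 2 |E| = 2 |V| - 2, so some vertex has degree below 2, and
  connectivity rules out degree 0.\<close>

lemma leaf_exists:
  assumes T: "is_tree T" and two: "card (verts T) \<ge> 2"
  obtains l p where "leaf T l p"
proof -
  have wf: "wf_graph T" and con: "connected_on T (verts T)"
    and ce: "card (edges T) + 1 = card (verts T)"
    using T by (auto simp: is_tree_def)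
  have fV: "finite (verts T)" using wf by (simp add: wf_graph_def)
  have fE: "finite (edges T)" using wf by (rule wf_graph_finite_edges)
  have e2: "card {v \<in> verts T. v \<in> e} = 2" if "e \<in> edges T" for e
  proof -
    obtain u v where "e = {u, v}" "u \<noteq> v" "u \<in> verts T" "v \<in> verts T"
      using wf_graph_edgeE[OF wf \<open>e \<in> edges T\<close>] by metis
    then have "{v \<in> verts T. v \<in> e} = {u, v}" by auto
    then show ?thesis using \<open>u \<noteq> v\<close> by simp
  qed
  have "(\<Sum>v\<in>verts T. card {e \<in> edges T. v \<in> e}) = 2 * card (edges T)"
    by (rule sum_multicount[OF fV fE]) (use e2 in auto)
  moreover have "2 * card (verts T) \<le> (\<Sum>v\<in>verts T. card {e \<in> edges T. v \<in> e})"
    if "\<forall>v\<in>verts T. 2 \<le> card {e \<in> edges T. v \<in> e}"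
    using sum_mono[of "verts T" "\<lambda>_. 2" "\<lambda>v. card {e \<in> edges T. v \<in> e}"] that by simp
  ultimately obtain l where l: "l \<in> verts T" and d: "card {e \<in> edges T. l \<in> e} < 2"
    using ce by fastforce
  obtain x where x: "x \<in> verts T" "x \<noteq> l"
    using two l by (metis card_le_Suc0_iff_eq fV not_less_eq_eq numeral_2_eq_2)
  have "(\<lambda>x y. x \<in> verts T \<and> y \<in> verts T \<and> adj T x y)\<^sup>*\<^sup>* l x"
    using con l x by (simp add: connected_on_def)
  then obtain p where p: "p \<in> verts T" "adj T l p"
    using x(2) by (cases rule: converse_rtranclpE) auto
  have "{l, p} \<in> {e \<in> edges T. l \<in> e}" using p by (auto simp: adj_def)
  moreover have "finite {e \<in> edges T. l \<in> e}" using fE by simp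
  moreover from this have "card {e \<in> edges T. l \<in> e} = 1"
    using d calculation by (metis (no_types, lifting) One_nat_def card_eq_0_iff empty_iff less_2_cases)
  ultimately have "{e \<in> edges T. l \<in> e} = {{l, p}}"
    by (metis (no_types, lifting) card_1_singletonE singletonD)
  then have "leaf T l p"
    using l p wf_graph_adjD[OF wf p(2)] by (simp add: leaf_def)
  then show thesis by (rule that)
qed

lemma connected_on_remove_leaf:
  assumes l: "leaf T l p" and con: "connected_on T A"
  shows "connected_on (remove_leaf T l p) (A - {l})"
  unfolding connected_on_def
proof (intro ballI)
  let ?S = "(\<lambda>x y. x \<in> A - {l} \<and> y \<in> A - {l} \<and> adj (remove_leaf T l p) x y)\<^sup>*\<^sup>*"
  fix u v assume uv: "u \<in> A - {l}" "v \<in> A - {l}"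
  have "(\<lambda>x y. x \<in> A \<and> y \<in> A \<and> adj T x y)\<^sup>*\<^sup>* u v"
    using con uv by (simp add: connected_on_def)
  \<comment> \<open>A walk enters and leaves \<open>l\<close> only through \<open>p\<close>; while
    it stands at \<open>l\<close>, the claim is kept for \<open>p\<close> instead.\<close>
  then have "(v \<noteq> l \<longrightarrow> ?S u v) \<and> (v = l \<longrightarrow> ?S u p)"
  proof (induction rule: rtranclp_induct)
    case base
    then show ?case using uv by auto
  next
    case (step y z)
    show ?case
    proof (cases "y = l \<or> z = l")
      case True
      then have "y = l \<and> z = p \<or> z = l \<and> y = p"
        using step.hyps leaf_adj[OF l, of y] leaf_adj[OF l, of z] adj_commute[of T y z] by metis
      then show ?thesis using step.IH leafD(3)[OF l] by auto
    next
      case False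
      then have "adj (remove_leaf T l p) y z" using step by (simp add: adj_remove_leaf[OF l])
      moreover have "?S u y" using step.IH False by blast
      ultimately have "?S u z"
        using step.hyps False by (elim rtranclp.rtrancl_into_rtrancl) blast
      then show ?thesis using False by blast
    qed
  qed
  then show "?S u v" using uv(2) by blast
qed

lemma connected_on_leaf_nbr:
  assumes l: "leaf T l p" and con: "connected_on T A" and "l \<in> A" "x \<in> A" "x \<noteq> l"
  shows "p \<in> A"
proof -
  have "(\<lambda>x y. x \<in> A \<and> y \<in> A \<and> adj T x y)\<^sup>*\<^sup>* l x"
    using assms by (simp add: connected_on_def)
  then show ?thesis
    using \<open>x \<noteq> l\<close> leaf_adj[OF l] by (cases rule: converse_rtranclpE) auto
qed

lemma is_tree_remove_leaf:
  assumes T: "is_tree T" and l: "leaf T l p"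
  shows "is_tree (remove_leaf T l p)"
proof -
  have wf: "wf_graph T" using T by (simp add: is_tree_def)
  have fV: "finite (verts T)" using wf by (simp add: wf_graph_def)
  have fE: "finite (edges T)" using wf by (rule wf_graph_finite_edges)
  have "wf_graph (remove_leaf T l p)"
    unfolding wf_graph_def
  proof (intro conjI ballI)
    fix e assume "e \<in> edges (remove_leaf T l p)"
    then have e: "e \<in> edges T" "e \<noteq> {l, p}" by (auto simp: remove_leaf_def)
    then have "l \<notin> e" using leafD(5)[OF l] by auto
    moreover obtain u v where "e = {u, v}" "u \<noteq> v" "u \<in> verts T" "v \<in> verts T"
      using wf_graph_edgeE[OF wf e(1)] by metis
    ultimately show "\<exists>u v. e = {u, v} \<and> u \<noteq> v \<and> u \<in> verts (remove_leaf T l p) \<and> v \<in> verts (remove_leaf T l p)"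
      by (intro exI[of _ u] exI[of _ v]) (simp add: remove_leaf_def, metis insertCI)
  qed (use fV in \<open>simp add: remove_leaf_def\<close>)
  moreover have "connected_on (remove_leaf T l p) (verts T - {l})"
    using T l by (intro connected_on_remove_leaf) (auto simp: is_tree_def)
  moreover have "{l, p} \<in> edges T" "l \<in> verts T" "p \<in> verts T - {l}"
    using leafD[OF l] by auto
  moreover have "card (edges T) > 0" using \<open>{l, p} \<in> edges T\<close> fE by (auto simp: card_gt_0_iff)
  ultimately show ?thesis
    using T fV fE by (auto simp: is_tree_def remove_leaf_def)
qed

lemma tree_induct [consumes 1, case_names single leaf]:
  assumes "is_tree T"
    and single: "\<And>T r. \<lbrakk>is_tree T; verts T = {r}\<rbrakk> \<Longrightarrow> P T"
    and leaf: "\<And>T l p. \<lbrakk>is_tree T; leaf T l p; is_tree (remove_leaf T l p); P (remove_leaf T l p)\<rbrakk> \<Longrightarrow> P T"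
  shows "P T"
  using assms(1)
proof (induction "card (verts T)" arbitrary: T rule: less_induct)
  case less
  have fV: "finite (verts T)" and ne: "verts T \<noteq> {}"
    using less.prems by (auto simp: is_tree_def wf_graph_def)
  show ?case
  proof (cases "card (verts T) \<ge> 2")
    case True
    then obtain l p where l: "leaf T l p" using leaf_exists[OF less.prems True] by metis
    have "card (verts (remove_leaf T l p)) < card (verts T)"
      using leafD(1)[OF l] fV card_Diff1_less[of "verts T" l] by simp
    then have "P (remove_leaf T l p)"
      using is_tree_remove_leaf[OF less.prems l] by (rule less.hyps)
    then show ?thesis
      using leaf[OF less.prems l is_tree_remove_leaf[OF less.prems l]] by metis
  next
    case False
    moreover have "card (verts T) \<noteq> 0" using fV ne by simp
    ultimately have "card (verts T) = 1" by linarith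
    then show ?thesis using single[OF less.prems] by (auto simp: card_1_singleton_iff)
  qed
qed

section \<open>Helly property of subtrees and clique minors\<close>

text \<open>Pruning a leaf preserves the hypotheses: unless some set is just \<open>{l}\<close>, in
  which case \<open>l\<close> lies in all of them, every set containing \<open>l\<close> also
  contains its neighbour \<open>p\<close>, so sets that met in \<open>l\<close> still meet in
  \<open>p\<close>.\<close>

lemma tree_Helly:
  assumes "is_tree T"
    and "\<And>i. i \<in> I \<Longrightarrow> A i \<subseteq> verts T \<and> connected_on T (A i)"
    and "\<And>i j. \<lbrakk>i \<in> I; j \<in> I\<rbrakk> \<Longrightarrow> A i \<inter> A j \<noteq> {}"
  shows "\<exists>x\<in>verts T. \<forall>i\<in>I. x \<in> A i"
  using assms
proof (induction arbitrary: A rule: tree_induct)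
  case (single T r)
  then show ?case by fastforce
next
  case (leaf T l p)
  show ?case
  proof (cases "\<exists>i\<in>I. A i = {l}")
    case True
    then obtain i where "i \<in> I" "A i = {l}" by auto
    then have "l \<in> A j" if "j \<in> I" for j using leaf.prems(2)[of i j] that by auto
    then show ?thesis using leafD(1)[OF leaf.hyps(2)] by (intro bexI[of _ l] ballI)
  next
    case False
    have p: "p \<in> A i" if i: "i \<in> I" "l \<in> A i" for i
    proof -
      obtain x where "x \<in> A i" "x \<noteq> l" using False i by blast
      then show ?thesis
        using connected_on_leaf_nbr[OF leaf.hyps(2), of "A i"] leaf.prems(1)[of i] i by auto
    qed
    have "\<exists>x\<in>verts (remove_leaf T l p). \<forall>i\<in>I. x \<in> A i - {l}"
    proof (rule leaf.IH)
      fix i assume "i \<in> I"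
      then show "A i - {l} \<subseteq> verts (remove_leaf T l p) \<and> connected_on (remove_leaf T l p) (A i - {l})"
        using leaf.prems(1)[of i] connected_on_remove_leaf[OF leaf.hyps(2), of "A i"] by auto
    next
      fix i j assume ij: "i \<in> I" "j \<in> I"
      obtain x where "x \<in> A i" "x \<in> A j" using leaf.prems(2)[OF ij] by auto
      then show "(A i - {l}) \<inter> (A j - {l}) \<noteq> {}"
        using p[of i] p[of j] ij leafD(3)[OF leaf.hyps(2)] by (cases "x = l") auto
    qed
    then show ?thesis by auto
  qed
qed

text \<open>The tree nodes whose bags meet one branch set form a subtree, and the subtrees of
  touching branch sets intersect. By the Helly property a single bag meets every branch set, and the
  branch sets are disjoint.\<close>

lemma treewidth_ge_clique_minor:
  fixes L :: "'i \<Rightarrow> 'a set"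
  assumes tw: "treewidth_le G k" and wf: "wf_graph G"
    and sub: "\<And>i. i \<in> I \<Longrightarrow> L i \<subseteq> verts G \<and> L i \<noteq> {} \<and> connected_on G (L i)"
    and disj: "\<And>i j. \<lbrakk>i \<in> I; j \<in> I; i \<noteq> j\<rbrakk> \<Longrightarrow> L i \<inter> L j = {}"
    and touch: "\<And>i j. \<lbrakk>i \<in> I; j \<in> I; i \<noteq> j\<rbrakk> \<Longrightarrow> \<exists>u\<in>L i. \<exists>v\<in>L j. adj G u v"
  shows "card I \<le> k + 1"
proof -
  obtain T bag where td: "tree_decomposition G T bag" and w: "\<forall>t\<in>verts T. card (bag t) \<le> k + 1"
    using tw by (auto simp: treewidth_le_def)
  have T: "is_tree T" and bs: "\<And>t. t \<in> verts T \<Longrightarrow> bag t \<subseteq> verts G"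
    and cov: "\<And>v. v \<in> verts G \<Longrightarrow> \<exists>t\<in>verts T. v \<in> bag t"
    and edg: "\<And>u v. \<lbrakk>u \<in> verts G; v \<in> verts G; adj G u v\<rbrakk> \<Longrightarrow> \<exists>t\<in>verts T. u \<in> bag t \<and> v \<in> bag t"
    and con: "\<And>v. v \<in> verts G \<Longrightarrow> connected_on T {t\<in>verts T. v \<in> bag t}"
    using td by (auto simp: tree_decomposition_def)
  define A where "A i = {t \<in> verts T. bag t \<inter> L i \<noteq> {}}" for i
  have "\<exists>t\<in>verts T. \<forall>i\<in>I. t \<in> A i"
  proof (rule tree_Helly[OF T], intro conjI)
    fix i assume i: "i \<in> I"
    show "A i \<subseteq> verts T" by (auto simp: A_def)
    let ?S = "(\<lambda>x y. x \<in> A i \<and> y \<in> A i \<and> adj T x y)\<^sup>*\<^sup>*"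
    have lift: "?S a b" if v: "v \<in> L i" and ab: "a \<in> verts T" "b \<in> verts T" "v \<in> bag a" "v \<in> bag b" for v a b
    proof -
      have "(\<lambda>x y. x \<in> {t\<in>verts T. v \<in> bag t} \<and> y \<in> {t\<in>verts T. v \<in> bag t} \<and> adj T x y)\<^sup>*\<^sup>* a b"
        using con[of v] v sub[OF i] ab unfolding connected_on_def by blast
      then show ?thesis
        by (rule rtranclp_mono[THEN predicate2D, rotated]) (use v in \<open>auto simp: A_def\<close>)
    qed
    have main: "?S a b" if "(\<lambda>x y. x \<in> L i \<and> y \<in> L i \<and> adj G x y)\<^sup>*\<^sup>* u v" "u \<in> L i" "u \<in> bag a" "v \<in> bag b"
      "a \<in> verts T" "b \<in> verts T" for u v a b
      using that
    proof (induction arbitrary: b rule: rtranclp_induct)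
      case base
      then show ?case using lift by blast
    next
      case (step y z)
      obtain c where c: "c \<in> verts T" "y \<in> bag c" "z \<in> bag c"
        using edg[of y z] step.hyps sub[OF i] by blast
      have "?S a c" using step c by blast
      moreover have "?S c b" using lift[of z c b] step c by blast
      ultimately show ?case by simp
    qed
    show "connected_on T (A i)"
      unfolding connected_on_def
    proof (intro ballI)
      fix a b assume ab: "a \<in> A i" "b \<in> A i"
      then obtain u v where "u \<in> L i" "v \<in> L i" "u \<in> bag a" "v \<in> bag b" by (auto simp: A_def)
      moreover have "(\<lambda>x y. x \<in> L i \<and> y \<in> L i \<and> adj G x y)\<^sup>*\<^sup>* u v"
        using sub[OF i] calculation by (auto simp: connected_on_def)
      ultimately show "?S a b" using main ab by (auto simp: A_def)
    qed
  next
    fix i j assume ij: "i \<in> I" "j \<in> I"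
    show "A i \<inter> A j \<noteq> {}"
    proof (cases "i = j")
      case True
      then show ?thesis using sub[OF ij(1)] cov unfolding A_def by blast
    next
      case False
      then obtain u v where "u \<in> L i" "v \<in> L j" "adj G u v" using touch ij by blast
      then show ?thesis using edg[of u v] sub[OF ij(1)] sub[OF ij(2)] unfolding A_def by blast
    qed
  qed
  then obtain t where t: "t \<in> verts T" "\<And>i. i \<in> I \<Longrightarrow> bag t \<inter> L i \<noteq> {}"
    by (auto simp: A_def)
  define g where "g i = (SOME x. x \<in> bag t \<inter> L i)" for i
  have g: "g i \<in> bag t \<inter> L i" if "i \<in> I" for i
    unfolding g_def using t(2)[OF that] by (intro some_in_eq[THEN iffD2])
  have "inj_on g I" using g disj by (fastforce simp: inj_on_def)
  moreover have "g ` I \<subseteq> bag t" using g by auto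
  moreover have "finite (bag t)"
    using bs[OF t(1)] wf by (auto simp: wf_graph_def intro: finite_subset)
  ultimately have "card I \<le> card (bag t)" by (metis card_image card_mono)
  then show ?thesis using w t(1) by fastforce
qed

section \<open>Tree decompositions from a parent function\<close>

definition parent_tree :: "'n set \<Rightarrow> 'n \<Rightarrow> ('n \<Rightarrow> 'n) \<Rightarrow> 'n sgraph" where
  "parent_tree Q r par = \<lparr>verts = Q, edges = (\<lambda>q. {q, par q}) ` (Q - {r})\<rparr>"

text \<open>The rank \<open>m\<close> makes every chain of parents finite. As only \<open>z\<close>
  may have its parent outside \<open>Y\<close>, each chain that starts in \<open>Y\<close> reaches
  \<open>z\<close> inside \<open>Y\<close>.\<close>

lemma connected_on_parent_tree:
  fixes m :: "'n \<Rightarrow> nat"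
  assumes dec: "\<And>q. q \<in> Q - {r} \<Longrightarrow> m (par q) < m q"
    and Y: "Y \<subseteq> Q" and top: "\<And>q. \<lbrakk>q \<in> Y; q \<noteq> z\<rbrakk> \<Longrightarrow> q \<noteq> r \<and> par q \<in> Y"
  shows "connected_on (parent_tree Q r par) Y"
proof -
  let ?R = "\<lambda>x y. x \<in> Y \<and> y \<in> Y \<and> adj (parent_tree Q r par) x y"
  have sym: "?R\<^sup>*\<^sup>* y x" if "?R\<^sup>*\<^sup>* x y" for x y
    using sympD[OF symp_rtranclp, of ?R x y] that by (simp add: symp_def adj_commute)
  have to_top: "?R\<^sup>*\<^sup>* q z" if "q \<in> Y" for q
    using that
  proof (induction "m q" arbitrary: q rule: less_induct)
    case less
    show ?case
    proof (cases "q = z")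
      case False
      then have q: "q \<noteq> r" "par q \<in> Y" using top less.prems by auto
      then have "?R q (par q)"
        using less.prems Y by (auto simp: parent_tree_def adj_def)
      moreover have "?R\<^sup>*\<^sup>* (par q) z" using less q Y dec[of q] by blast
      ultimately show ?thesis by (rule converse_rtranclp_into_rtranclp)
    qed simp
  qed
  show ?thesis
    unfolding connected_on_def using to_top sym by (meson rtranclp_trans)
qed

lemma is_tree_parent_tree:
  fixes m :: "'n \<Rightarrow> nat"
  assumes fin: "finite Q" and r: "r \<in> Q"
    and par: "\<And>q. q \<in> Q - {r} \<Longrightarrow> par q \<in> Q \<and> m (par q) < m q"
  shows "is_tree (parent_tree Q r par)"
proof -
  \<comment> \<open>Two nodes with the same edge would be parents of each other, against the rank
    \<open>m\<close>; so there is one edge for each node other than the root.\<close>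
  have "inj_on (\<lambda>q. {q, par q}) (Q - {r})"
  proof (rule inj_onI)
    fix x y assume "x \<in> Q - {r}" "y \<in> Q - {r}" "{x, par x} = {y, par y}"
    then show "x = y" using par[of x] par[of y] by (auto simp: doubleton_eq_iff)
  qed
  then have "card ((\<lambda>q. {q, par q}) ` (Q - {r})) = card Q - 1"
    using fin r by (simp add: card_image)
  moreover have "card Q > 0" using fin r by (auto simp: card_gt_0_iff)
  moreover have "connected_on (parent_tree Q r par) Q"
    using par by (intro connected_on_parent_tree[where m = m and z = r]) auto
  moreover have "wf_graph (parent_tree Q r par)"
    unfolding wf_graph_def parent_tree_def using fin par by fastforce
  ultimately show ?thesis using r by (auto simp: is_tree_def parent_tree_def)
qed

text \<open>Connectivity of the nodes that hold a vertex becomes a local condition: they climb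
  parent by parent to one top node \<open>z\<close>. The injection \<open>e\<close> renames the
  nodes to natural numbers, as \<open>tree_decomposition\<close> demands.\<close>

lemma treewidth_le_parent_tree:
  fixes m :: "'n \<Rightarrow> nat"
  assumes fin: "finite Q" and r: "r \<in> Q"
    and par: "\<And>q. q \<in> Q - {r} \<Longrightarrow> par q \<in> Q \<and> m (par q) < m q"
    and bag: "\<And>q. q \<in> Q \<Longrightarrow> X q \<subseteq> verts G \<and> card (X q) \<le> k + 1"
    and cov: "\<And>v. v \<in> verts G \<Longrightarrow> \<exists>q\<in>Q. v \<in> X q"
    and edg: "\<And>u v. \<lbrakk>u \<in> verts G; v \<in> verts G; adj G u v\<rbrakk> \<Longrightarrow> \<exists>q\<in>Q. u \<in> X q \<and> v \<in> X q"
    and con: "\<And>v. v \<in> verts G \<Longrightarrow> \<exists>z. \<forall>q\<in>Q. v \<in> X q \<longrightarrow> q \<noteq> z \<longrightarrow> q \<noteq> r \<and> v \<in> X (par q)"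
  shows "treewidth_le G k"
proof -
  obtain e :: "'n \<Rightarrow> nat" where e: "inj_on e Q"
    using finite_imp_inj_to_nat_seg[OF fin] by metis
  define d where "d = inv_into Q e"
  have de: "d (e q) = q" if "q \<in> Q" for q using e that by (simp add: d_def)
  define T where "T = parent_tree (e ` Q) (e r) (e \<circ> par \<circ> d)"
  have par': "(e \<circ> par \<circ> d) q \<in> e ` Q \<and> m (d ((e \<circ> par \<circ> d) q)) < m (d q)" if "q \<in> e ` Q - {e r}" for q
  proof -
    from that obtain q' where "q = e q'" "q' \<in> Q - {r}" by auto
    then show ?thesis using par[of q'] by (auto simp: de)
  qed
  have V: "verts T = e ` Q" by (simp add: T_def parent_tree_def)
  have "is_tree T"
    unfolding T_def using fin r par' by (intro is_tree_parent_tree[where m = "m \<circ> d"]) auto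
  moreover have "connected_on T {q \<in> verts T. v \<in> (X \<circ> d) q}" if "v \<in> verts G" for v
  proof -
    obtain z where z: "\<And>q. \<lbrakk>q \<in> Q; v \<in> X q; q \<noteq> z\<rbrakk> \<Longrightarrow> q \<noteq> r \<and> v \<in> X (par q)" using con \<open>v \<in> verts G\<close> by blast
    have "q \<noteq> e r \<and> (e \<circ> par \<circ> d) q \<in> {q \<in> e ` Q. v \<in> (X \<circ> d) q}"
      if q: "q \<in> {q \<in> e ` Q. v \<in> (X \<circ> d) q}" "q \<noteq> e z" for q
    proof -
      obtain q' where q': "q' \<in> Q" "q = e q'" "v \<in> X q'" using q by (auto simp: de)
      then have "q' \<noteq> r" "v \<in> X (par q')" using z[of q'] q by auto
      moreover have "q \<noteq> e r" using q' calculation e r by (metis inj_on_eq_iff)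
      ultimately show ?thesis using q' par[of q'] by (auto simp: de)
    qed
    then show ?thesis
      unfolding V unfolding T_def
      using par' by (intro connected_on_parent_tree[where m = "m \<circ> d" and z = "e z"]) auto
  qed
  ultimately have "tree_decomposition G T (X \<circ> d)"
    unfolding tree_decomposition_def V using bag cov edg by (auto simp: de)
  then show ?thesis
    unfolding treewidth_le_def using bag V by (force simp: de)
qed

section \<open>Rooted decompositions\<close>

text \<open>A form of tree decomposition made for recursion. The last condition of
  \<open>join\<close> is the separation property of the tree edge between the two roots; each piece
  can be treated once the bag of its own root is embedded.\<close>

inductive rooted_td :: "(nat \<Rightarrow> 'b set) \<Rightarrow> nat \<Rightarrow> nat set \<Rightarrow> bool" for bag where
  single: "rooted_td bag r {r}"
| join: "\<lbrakk>rooted_td bag r N; rooted_td bag c N'; N \<inter> N' = {};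
    \<Union> (bag ` N) \<inter> \<Union> (bag ` N') \<subseteq> bag r \<inter> bag c\<rbrakk> \<Longrightarrow> rooted_td bag r (N \<union> N')"

lemma rooted_td_root: "rooted_td bag r N \<Longrightarrow> r \<in> N"
  by (induction rule: rooted_td.induct) auto

lemma rooted_td_finite: "rooted_td bag r N \<Longrightarrow> finite N"
  by (induction rule: rooted_td.induct) auto

text \<open>Tree induction adds a leaf anywhere, whereas \<open>join\<close> attaches at the root;
  the leaf is therefore passed down to the piece that contains its neighbour
  \<open>p\<close>.\<close>

lemma rooted_td_insert_leaf:
  assumes "rooted_td bag r N" "p \<in> N" "l \<notin> N" "bag l \<inter> \<Union> (bag ` N) \<subseteq> bag p"
  shows "rooted_td bag r (insert l N)"
  using assms
proof (induction rule: rooted_td.induct)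
  case (single r)
  then have "rooted_td bag r ({r} \<union> {l})"
    by (intro rooted_td.join[where c = l] rooted_td.single) auto
  then show ?case by (simp add: insert_commute)
next
  case (join r N c N')
  show ?case
  proof (cases "p \<in> N")
    case True
    have "rooted_td bag r (insert l N \<union> N')"
    proof (rule rooted_td.join)
      show "rooted_td bag r (insert l N)" using join True by auto
      show "\<Union> (bag ` insert l N) \<inter> \<Union> (bag ` N') \<subseteq> bag r \<inter> bag c"
        using join.hyps(4) join.prems True by blast
    qed (use join in auto)
    then show ?thesis by simp
  next
    case False
    have "rooted_td bag r (N \<union> insert l N')"
    proof (rule rooted_td.join)
      show "rooted_td bag c (insert l N')" using join False by auto
      show "\<Union> (bag ` N) \<inter> \<Union> (bag ` insert l N') \<subseteq> bag r \<inter> bag c"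
        using join.hyps(4) join.prems False by blast
    qed (use join in auto)
    then show ?thesis by simp
  qed
qed

lemma rooted_td_exists:
  assumes "is_tree T" and "\<And>v. connected_on T {t \<in> verts T. v \<in> bag t}"
  shows "\<exists>r. rooted_td bag r (verts T)"
  using assms
proof (induction rule: tree_induct)
  case (single T r)
  then show ?case using rooted_td.single by metis
next
  case (leaf T l p)
  let ?T = "remove_leaf T l p"
  have "{t \<in> verts ?T. v \<in> bag t} = {t \<in> verts T. v \<in> bag t} - {l}" for v
    by auto
  then have "connected_on ?T {t \<in> verts ?T. v \<in> bag t}" for v
    using connected_on_remove_leaf[OF leaf.hyps(2) leaf.prems] by simp
  then obtain r where r: "rooted_td bag r (verts ?T)" using leaf.IH by blast
  have "rooted_td bag r (insert l (verts ?T))"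
  proof (rule rooted_td_insert_leaf[OF r])
    show "p \<in> verts ?T" "l \<notin> verts ?T" using leafD[OF leaf.hyps(2)] by auto
    show "bag l \<inter> \<Union> (bag ` verts ?T) \<subseteq> bag p"
    proof
      fix v assume "v \<in> bag l \<inter> \<Union> (bag ` verts ?T)"
      then obtain x where "v \<in> bag l" "x \<in> verts T" "x \<noteq> l" "v \<in> bag x" by auto
      then show "v \<in> bag p"
        using connected_on_leaf_nbr[OF leaf.hyps(2) leaf.prems, of v x] leafD(1)[OF leaf.hyps(2)] by auto
    qed
  qed
  moreover have "insert l (verts ?T) = verts T" using leafD(1)[OF leaf.hyps(2)] by auto
  ultimately show ?case by auto
qed

section \<open>The layered graph\<close>

type_synonym node = "nat \<times> int"

text \<open>Node \<open>(l, j)\<close> is the \<open>j\<close>-th node of layer \<open>l\<close>, and its parent is \<open>(l - 1, j div M)\<close>. Each node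
  remembers some of its ancestors in \<open>s\<close> slots; passing to the child \<open>j\<close> overwrites slot \<open>slot j\<close>
  by the parent. A child may be joined to the ancestors in the slots \<open>mask j\<close>. Odd children, which
  are not joined to any ancestor, keep the other ones apart from each other within the layer.\<close>

locale layered_graph =
  fixes s :: nat and M :: int and slot :: "int \<Rightarrow> nat" and mask :: "int \<Rightarrow> nat set"
  assumes two_le_s: "2 \<le> s" and M_gt_1: "1 < M"
    and slot_less: "slot j < s"
    and mask_odd: "odd j \<Longrightarrow> mask j = {}"
    and codes: "\<lbrakk>q < s; Z \<subseteq> {..<s}\<rbrakk> \<Longrightarrow> \<exists>j. j div M = p \<and> even j \<and> slot j = q \<and> mask j = Z"
begin

primrec slots :: "nat \<Rightarrow> int \<Rightarrow> nat \<Rightarrow> node option" where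
  "slots 0 = (\<lambda>j q. None)"
| "slots (Suc l) = (\<lambda>j. (slots l (j div M))(slot j := Some (l, j div M)))"

definition stored :: "node \<Rightarrow> node set" where
  "stored v = ran (slots (fst v) (snd v))"

definition cand :: "node \<Rightarrow> node set" where
  "cand v = {x. \<exists>q\<in>mask (snd v). slots (fst v) (snd v) q = Some x}"

text \<open>Independence of \<open>cand v\<close> is tested in the candidate graph instead of the final one, which
  avoids a recursion.\<close>

definition clean :: "node \<Rightarrow> bool" where
  "clean v \<longleftrightarrow> (\<forall>x\<in>cand v. \<forall>y\<in>cand v. x \<notin> cand y)"

definition up :: "node \<Rightarrow> node set" where
  "up v = (if clean v then cand v else {})"

definition ladj :: "node \<Rightarrow> node \<Rightarrow> bool" where
  "ladj u v \<longleftrightarrow> fst u = fst v \<and> \<bar>snd u - snd v\<bar> = 1 \<or> u \<in> up v \<or> v \<in> up u"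

definition child :: "node \<Rightarrow> node \<Rightarrow> bool" where
  "child u v \<longleftrightarrow> fst v = Suc (fst u) \<and> snd v div M = snd u"

text \<open>Closed form of the reflexive transitive closure of \<open>child\<close>: repeated
  division by \<open>M\<close> is division by a power of \<open>M\<close>.\<close>

definition desc :: "node \<Rightarrow> node \<Rightarrow> bool" where
  "desc u v \<longleftrightarrow> fst u \<le> fst v \<and> snd v div M ^ (fst v - fst u) = snd u"

lemma desc_refl [simp]: "desc u u"
  by (simp add: desc_def)

lemma desc_trans:
  assumes "desc u v" "desc v w"
  shows "desc u w"
proof -
  have "fst w - fst u = (fst w - fst v) + (fst v - fst u)"
    using assms by (auto simp: desc_def)
  then have "snd w div M ^ (fst w - fst u) = snd w div M ^ (fst w - fst v) div M ^ (fst v - fst u)"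
    using M_gt_1 by (simp add: power_add zdiv_zmult2_eq)
  then show ?thesis using assms by (auto simp: desc_def)
qed

lemma child_desc: "child u v \<Longrightarrow> desc u v \<and> fst u < fst v"
  by (auto simp: child_def desc_def)

lemma desc_linear:
  assumes "desc u x" "desc v x" "fst u \<le> fst v"
  shows "desc u v"
proof -
  have "fst x - fst u = (fst x - fst v) + (fst v - fst u)"
    using assms by (auto simp: desc_def)
  then have "snd x div M ^ (fst x - fst u) = snd x div M ^ (fst x - fst v) div M ^ (fst v - fst u)"
    using M_gt_1 by (simp add: power_add zdiv_zmult2_eq)
  then show ?thesis using assms by (auto simp: desc_def)
qed

lemma desc_same_level: "\<lbrakk>desc u v; fst u = fst v\<rbrakk> \<Longrightarrow> u = v"
  by (auto simp: desc_def prod_eq_iff)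

lemma slots_child: "child u v \<Longrightarrow> slots (fst v) (snd v) = (slots (fst u) (snd u))(slot (snd v) := Some u)"
  by (simp add: child_def)

lemma stored_child: "child u v \<Longrightarrow> stored v \<subseteq> insert u (stored u)"
  by (auto simp: stored_def slots_child ran_def)

lemma parent_exists: "fst v = Suc l \<Longrightarrow> child (l, snd v div M) v"
  by (simp add: child_def)

lemma stored_0: "fst v = 0 \<Longrightarrow> stored v = {}"
  by (simp add: stored_def)

lemma stored_desc: "x \<in> stored v \<Longrightarrow> desc x v \<and> fst x < fst v"
proof (induction "fst v" arbitrary: v)
  case 0
  then show ?case by (simp add: stored_0)
next
  case (Suc l)
  let ?u = "(l, snd v div M)"
  have c: "child ?u v" using Suc.hyps(2) parent_exists[of v l] by simp
  then consider "x = ?u" | "x \<in> stored ?u" using stored_child Suc.prems by blast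
  then show ?case
  proof cases
    case 1
    then show ?thesis using child_desc[OF c] by simp
  next
    case 2
    then have "desc x ?u \<and> fst x < l" using Suc.hyps(1)[of ?u] by simp
    then show ?thesis using child_desc[OF c] desc_trans[of x ?u v] by auto
  qed
qed

lemma slots_less: "slots l j q = Some x \<Longrightarrow> q < s"
  by (induction l arbitrary: j) (auto simp: slot_less split: if_splits)

lemma stored_card: "finite (stored v)" "card (stored v) \<le> s"
proof -
  have sub: "stored v \<subseteq> (\<lambda>q. the (slots (fst v) (snd v) q)) ` {..<s}"
    using slots_less by (force simp: stored_def ran_def image_iff)
  then show "finite (stored v)" by (rule finite_subset) simp
  show "card (stored v) \<le> s"
    using card_mono[OF _ sub] card_image_le[of "{..<s}" "\<lambda>q. the (slots (fst v) (snd v) q)"] by simp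
qed

lemma cand_stored: "cand v \<subseteq> stored v"
  by (auto simp: cand_def stored_def ran_def)

lemma up_cand: "up v \<subseteq> cand v"
  by (auto simp: up_def)

lemma up_desc: "x \<in> up v \<Longrightarrow> desc x v \<and> fst x < fst v"
  using up_cand cand_stored stored_desc by blast

lemma up_even: "x \<in> up v \<Longrightarrow> even (snd v)"
  using up_cand[of v] mask_odd[of "snd v"] by (auto simp: cand_def)

section \<open>Children with prescribed memory and candidates\<close>

text \<open>Fewer than \<open>s\<close> nodes occupy fewer than \<open>s\<close> slots, so some slot
  can be overwritten by \<open>v\<close> without forgetting anything in \<open>F\<close>. If
  \<open>v\<close> itself belongs to \<open>F\<close>, it enters the memory through that very
  slot.\<close>

lemma free_slot:
  assumes F: "F \<subseteq> insert v (stored v)" "finite F" "card F < s"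
  shows "\<exists>q<s. \<forall>c. child v c \<longrightarrow> slot (snd c) = q \<longrightarrow> F \<subseteq> stored c"
proof -
  have "\<exists>q. slots (fst v) (snd v) q = Some x" if "x \<in> F - {v}" for x
    using F(1) that by (auto simp: stored_def ran_def)
  then obtain g where g: "\<And>x. x \<in> F - {v} \<Longrightarrow> slots (fst v) (snd v) (g x) = Some x"
    by metis
  have "\<not> {..<s} \<subseteq> g ` F"
    using card_mono[of "g ` F" "{..<s}"] card_image_le[OF F(2), of g] F(2,3) by auto
  then obtain q where q: "q < s" "q \<notin> g ` F" by auto
  have "F \<subseteq> stored c" if c: "child v c" "slot (snd c) = q" for c
  proof
    fix x assume x: "x \<in> F"
    show "x \<in> stored c"
    proof (cases "x = v")
      case True
      then have "slots (fst c) (snd c) q = Some x" by (simp add: slots_child[OF c(1)] c(2))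
      then show ?thesis by (auto simp: stored_def ran_def)
    next
      case False
      then have "slots (fst c) (snd c) (g x) = Some x"
        using g x q by (auto simp: slots_child[OF c(1)] c(2))
      then show ?thesis by (auto simp: stored_def ran_def)
    qed
  qed
  then show ?thesis using q by blast
qed

lemma child_code:
  assumes "q < s" "Z \<subseteq> {..<s}"
  shows "\<exists>c. child v c \<and> even (snd c) \<and> slot (snd c) = q \<and> mask (snd c) = Z"
proof -
  obtain j where "j div M = snd v" "even j" "slot j = q" "mask j = Z"
    using codes[OF assms] by metis
  then show ?thesis by (intro exI[of _ "(Suc (fst v), j)"]) (simp add: child_def)
qed

lemma child_exists:
  assumes F: "F \<subseteq> insert v (stored v)" "finite F" "card F < s" and Z: "Z \<subseteq> F"
  shows "\<exists>c. child v c \<and> F \<subseteq> stored c \<and> cand c = Z"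
proof -
  obtain q where q: "q < s" "\<And>c. \<lbrakk>child v c; slot (snd c) = q\<rbrakk> \<Longrightarrow> F \<subseteq> stored c"
    using free_slot[OF F] by blast
  \<comment> \<open>The mask has to be chosen with respect to the memory of the child, in which slot
    \<open>q\<close> already holds \<open>v\<close>.\<close>
  let ?b = "(slots (fst v) (snd v))(q := Some v)"
  have sub: "{r. \<exists>x\<in>Z. ?b r = Some x} \<subseteq> {..<s}"
  proof
    fix r assume "r \<in> {r. \<exists>x\<in>Z. ?b r = Some x}"
    then obtain x where "?b r = Some x" by blast
    then show "r \<in> {..<s}"
      using q(1) slots_less[of "fst v" "snd v" r x] by (cases "r = q") simp_all
  qed
  obtain c where c: "child v c" "slot (snd c) = q" "mask (snd c) = {r. \<exists>x\<in>Z. ?b r = Some x}"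
    using child_code[OF q(1) sub, of v] by blast
  have b: "slots (fst c) (snd c) = ?b" by (simp only: slots_child[OF c(1)] c(2))
  have st: "F \<subseteq> stored c" using q c by blast
  have dec: "{x. \<exists>r\<in>{r. \<exists>x\<in>Z. b r = Some x}. b r = Some x} = Z" if "Z \<subseteq> ran b" for b :: "nat \<Rightarrow> node option"
    using that by (fastforce simp: ran_def)
  have "Z \<subseteq> ran ?b" using st Z by (simp add: stored_def b)
  then have "cand c = Z" unfolding cand_def b c(3) by (rule dec)
  then show ?thesis using c st by blast
qed

text \<open>The two codes share the slot and differ in the mask. Both children are even, so being
  distinct they are at distance at least 2.\<close>

lemma two_children:
  assumes F: "F \<subseteq> insert v (stored v)" "finite F" "card F < s"
  obtains c d where "child v c" "child v d" "F \<subseteq> stored c" "F \<subseteq> stored d" "2 \<le> \<bar>snd c - snd d\<bar>"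
proof -
  obtain q where q: "q < s" "\<And>c. \<lbrakk>child v c; slot (snd c) = q\<rbrakk> \<Longrightarrow> F \<subseteq> stored c"
    using free_slot[OF F] by blast
  obtain c where c: "child v c" "even (snd c)" "slot (snd c) = q" "mask (snd c) = {}"
    using child_code[OF q(1), of "{}" v] by blast
  have zero: "{0} \<subseteq> {..<s}" using two_le_s by simp
  obtain d where d: "child v d" "even (snd d)" "slot (snd d) = q" "mask (snd d) = {0}"
    using child_code[OF q(1) zero, of v] by blast
  have "snd c \<noteq> snd d" using c d by auto
  moreover have "even (snd c - snd d)" using c d by simp
  ultimately have "2 \<le> \<bar>snd c - snd d\<bar>" by presburger
  then show thesis using that c d q by blast
qed

section \<open>Triangles and bicliques\<close>

lemma ladj_commute: "ladj u v \<longleftrightarrow> ladj v u"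
  by (auto simp: ladj_def abs_minus_commute)

lemma ladj_irrefl: "\<not> ladj u u"
  using up_desc[of u u] by (auto simp: ladj_def)

lemma ladj_lower: "\<lbrakk>ladj u v; fst u < fst v\<rbrakk> \<Longrightarrow> u \<in> up v"
  using up_desc[of v u] by (auto simp: ladj_def)

lemma ladj_below: "fst u < fst v \<Longrightarrow> ladj u v \<longleftrightarrow> u \<in> up v"
  using up_desc[of v u] by (auto simp: ladj_def)

lemma ladj_same_level: "\<lbrakk>ladj u v; fst u = fst v\<rbrakk> \<Longrightarrow> \<bar>snd u - snd v\<bar> = 1"
  using up_desc[of v u] up_desc[of u v] by (auto simp: ladj_def)

text \<open>Here \<open>x\<close> lies in the deepest layer of the triangle. A neighbour of
  \<open>x\<close> in its layer has the other parity, and odd nodes have no upward edges, so the two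
  share no upper neighbour. Two upper neighbours of \<open>x\<close> are ancestors of
  \<open>x\<close>, hence comparable, and an edge between them contradicts the cleanness of
  \<open>x\<close>.\<close>

lemma no_triangle_below:
  assumes "ladj x y" "ladj x z" "ladj y z" "fst y \<le> fst x" "fst z \<le> fst x"
  shows False
proof -
  have mixed: False if "ladj x y" "ladj x z" "ladj y z" "fst y = fst x" "fst z < fst x" for y z
  proof -
    have "z \<in> up x" "z \<in> up y"
      using that ladj_lower[of z x] ladj_lower[of z y] by (auto simp: ladj_commute)
    then have "even (snd x)" "even (snd y)" by (auto dest: up_even)
    then show False using ladj_same_level[of x y] that by (auto simp: abs_if split: if_splits) presburger+
  qed
  have upper: False if "ladj x y" "ladj x z" "ladj y z" "fst y \<le> fst z" "fst z < fst x" for y z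
  proof -
    have xy: "y \<in> up x" "z \<in> up x"
      using that ladj_lower[of z x] ladj_lower[of y x] by (auto simp: ladj_commute)
    then have "desc y z" using up_desc[of y x] up_desc[of z x] desc_linear that by blast
    then have "fst y < fst z"
      using desc_same_level[of y z] that ladj_irrefl[of y] by force
    then have "y \<in> up z" using ladj_lower that by blast
    then have "y \<in> cand z" using up_cand by blast
    moreover have "clean x" "y \<in> cand x" "z \<in> cand x"
      using xy by (auto simp: up_def split: if_splits)
    ultimately show False by (auto simp: clean_def)
  qed
  consider "fst y = fst x" "fst z = fst x" | "fst y = fst x" "fst z < fst x"
    | "fst y < fst x" "fst z = fst x" | "fst y < fst x" "fst z < fst x"
    using assms by linarith
  then show False
  proof cases
    case 1
    then show False
      using ladj_same_level[of x y] ladj_same_level[of x z] ladj_same_level[of y z] assms by linarith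
  next
    case 2
    then show False using mixed assms by blast
  next
    case 3
    then show False using mixed[of z y] assms ladj_commute[of y z] by blast
  next
    case 4
    then show False
      using upper[of y z] upper[of z y] assms ladj_commute[of y z] by (metis nat_le_linear)
  qed
qed

lemma no_triangle:
  assumes "ladj x y" "ladj y z" "ladj x z"
  shows False
proof -
  consider "fst y \<le> fst x" "fst z \<le> fst x" | "fst x \<le> fst y" "fst z \<le> fst y" | "fst x \<le> fst z" "fst y \<le> fst z"
    by linarith
  then show False
    using no_triangle_below[of x y z] no_triangle_below[of y x z] no_triangle_below[of z x y] assms
      ladj_commute[of x y] ladj_commute[of x z] ladj_commute[of y z]
    by cases blast+
qed

lemma card_lower_nbrs:
  assumes "\<And>y. y \<in> A \<Longrightarrow> ladj v y \<and> fst y \<le> fst v"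
  shows "finite A" "card A \<le> s + 2"
proof -
  let ?B = "{(fst v, snd v + 1), (fst v, snd v - 1)} \<union> stored v"
  have sub: "A \<subseteq> ?B"
  proof
    fix y assume "y \<in> A"
    then have y: "ladj v y" "fst y \<le> fst v" using assms by auto
    show "y \<in> ?B"
    proof (cases "fst y = fst v")
      case True
      then have "\<bar>snd v - snd y\<bar> = 1" using ladj_same_level y by simp
      then have "snd y = snd v + 1 \<or> snd y = snd v - 1" by linarith
      then show ?thesis using True by (auto simp: prod_eq_iff)
    next
      case False
      then have "y \<in> up v" using y ladj_lower[of y v] ladj_commute by simp
      then show ?thesis using up_cand cand_stored by blast
    qed
  qed
  have fin: "finite ?B" using stored_card(1) by simp
  show "finite A" using sub fin by (rule finite_subset)
  have "card ?B \<le> 2 + s"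
    using card_Un_le[of "{(fst v, snd v + 1), (fst v, snd v - 1)}" "stored v"] stored_card(2)[of v]
    by (simp add: card_insert_if)
  then show "card A \<le> s + 2" using card_mono[OF fin sub] by simp
qed

text \<open>A deepest node of the biclique would have \<open>s + 3\<close> neighbours in layers that
  are no deeper, but only two neighbours in its layer and \<open>s\<close> remembered ancestors are
  available.\<close>

lemma no_biclique:
  assumes "finite A" "finite B" "card A = s + 3" "card B = s + 3"
    and adj: "\<And>a b. \<lbrakk>a \<in> A; b \<in> B\<rbrakk> \<Longrightarrow> ladj a b"
  shows False
proof -
  have "finite (fst ` (A \<union> B))" "fst ` (A \<union> B) \<noteq> {}" using assms by auto
  then have "Max (fst ` (A \<union> B)) \<in> fst ` (A \<union> B)" "\<forall>x\<in>A \<union> B. fst x \<le> Max (fst ` (A \<union> B))"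
    by (auto intro: Max_in Max_ge)
  then obtain v where v: "v \<in> A \<union> B" "\<And>x. x \<in> A \<union> B \<Longrightarrow> fst x \<le> fst v" by (metis imageE)
  from v(1) show False
  proof
    assume "v \<in> A"
    then have "card B \<le> s + 2" using adj v(2) by (intro card_lower_nbrs(2)[of B v]) simp
    then show False using assms(4) by simp
  next
    assume "v \<in> B"
    then have "card A \<le> s + 2"
      using adj v(2) by (intro card_lower_nbrs(2)[of A v]) (simp add: ladj_commute[of v])
    then show False using assms(3) by simp
  qed
qed

subsection \<open>Thickness\<close>

text \<open>The recursion runs over the number of layers still to be visited, as the layer index
  itself increases along a path.\<close>

primrec thick_upto :: "node set \<Rightarrow> nat \<Rightarrow> node \<Rightarrow> nat" where
  "thick_upto P 0 = (\<lambda>u. 0)"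
| "thick_upto P (Suc m) = (\<lambda>u. of_bool (u \<in> P) + Min (thick_upto P m ` {c. child u c}))"

text \<open>The least number of elements of \<open>P\<close> on a descending path that starts in \<open>u\<close>, provided that
  \<open>P\<close> lies in the layers with index less than \<open>n\<close>.\<close>

definition thick :: "node set \<Rightarrow> nat \<Rightarrow> node \<Rightarrow> nat" where
  "thick P n u = thick_upto P (n - fst u) u"

lemma children_finite: "finite {c. child u c}"
proof (rule finite_subset)
  show "{c. child u c} \<subseteq> {Suc (fst u)} \<times> {snd u * M..<snd u * M + M}"
  proof
    fix c assume "c \<in> {c. child u c}"
    then have c: "fst c = Suc (fst u)" "snd c div M = snd u" by (auto simp: child_def)
    have "snd c = snd u * M + snd c mod M" using c(2) div_mult_mod_eq[of "snd c" M] by simp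
    moreover have "0 \<le> snd c mod M" "snd c mod M < M" using M_gt_1 by auto
    ultimately show "c \<in> {Suc (fst u)} \<times> {snd u * M..<snd u * M + M}"
      using c(1) by (auto simp: mem_Times_iff)
  qed
qed simp

lemma children_nonempty: "{c. child u c} \<noteq> {}"
  using child_code[of 0 "{}" u] two_le_s by force

lemma thick_top: "n \<le> fst u \<Longrightarrow> thick P n u = 0"
  by (simp add: thick_def)

lemma thick_step:
  assumes "fst u < n"
  shows "thick P n u = of_bool (u \<in> P) + Min (thick P n ` {c. child u c})"
proof -
  obtain m where m: "n - fst u = Suc m" using assms by (metis Suc_diff_Suc)
  have "thick P n c = thick_upto P m c" if "child u c" for c
  proof -
    have "n - fst c = m" using that m by (auto simp: child_def)
    then show ?thesis by (simp add: thick_def)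
  qed
  then have "thick P n ` {c. child u c} = thick_upto P m ` {c. child u c}" by auto
  then show ?thesis by (simp add: thick_def m)
qed

lemma thick_child_le: "child u c \<Longrightarrow> thick P n u \<le> of_bool (u \<in> P) + thick P n c"
  using Min_le[of "thick P n ` {c. child u c}" "thick P n c"] children_finite[of u] thick_step[of u n P]
    thick_top[of n u P]
  by (cases "fst u < n") auto

lemma thick_child_eq:
  assumes "fst u < n"
  obtains c where "child u c" "thick P n u = of_bool (u \<in> P) + thick P n c"
proof -
  have "Min (thick P n ` {c. child u c}) \<in> thick P n ` {c. child u c}"
    using children_finite[of u] children_nonempty[of u] by (intro Min_in) auto
  then show thesis using that thick_step[OF assms, of P] by auto
qed

text \<open>Keep choosing a child that remembers \<open>F\<close> and has candidate set
  \<open>Z\<close>. Outside \<open>P\<close> such a step loses no thickness, and from layer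
  \<open>n\<close> on there is none left, so \<open>P\<close> must be hit. At most one unit is lost,
  for \<open>v\<close> itself.\<close>

lemma thick_introduce:
  assumes F: "F \<subseteq> insert v (stored v)" "finite F" "card F < s" "Z \<subseteq> F"
    and th: "thick P n v \<ge> Suc k" and k: "k \<ge> 1"
  shows "\<exists>w\<in>P. desc v w \<and> fst v < fst w \<and> cand w = Z \<and> F \<subseteq> stored w \<and> thick P n w \<ge> k"
proof -
  \<comment> \<open>The bound on \<open>v\<close> is too strong to be inherited, since a child is
    only known to have thickness at least \<open>k\<close>. The second alternative can be refuted
    one level down: a node outside \<open>P\<close> of thickness at least \<open>k\<close> has no
    child below \<open>k\<close>.\<close>
  have "(\<exists>w\<in>P. desc v w \<and> fst v < fst w \<and> cand w = Z \<and> F \<subseteq> stored w \<and> thick P n w \<ge> k) \<or>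
      (\<exists>c. child v c \<and> thick P n c < k)"
    using F(1)
  proof (induction "n - fst v" arbitrary: v)
    case 0
    then obtain c where "child v c" using children_nonempty[of v] by auto
    then have "thick P n c = 0" using 0 child_desc[of v c] by (intro thick_top) auto
    then show ?case using \<open>child v c\<close> k by (intro disjI2 exI[of _ c]) simp
  next
    case (Suc m)
    obtain c where c: "child v c" "F \<subseteq> stored c" "cand c = Z"
      using child_exists[OF Suc.prems F(2-4)] by blast
    show ?case
    proof (cases "thick P n c < k")
      case True
      then show ?thesis using c by blast
    next
      case False
      show ?thesis
      proof (cases "c \<in> P")
        case True
        then show ?thesis using False c child_desc[OF c(1)] by (intro disjI1 bexI[of _ c]) auto
      next
        case cP: False
        have "m = n - fst c" using Suc.hyps(2) c(1) by (auto simp: child_def)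
        then have IH: "(\<exists>w\<in>P. desc c w \<and> fst c < fst w \<and> cand w = Z \<and> F \<subseteq> stored w \<and> thick P n w \<ge> k) \<or>
            (\<exists>c'. child c c' \<and> thick P n c' < k)"
          using c(2) by (intro Suc.hyps(1)) auto
        have "\<not> thick P n c' < k" if "child c c'" for c'
          using thick_child_le[OF that, of P n] False cP by simp
        then have "\<exists>w\<in>P. desc c w \<and> fst c < fst w \<and> cand w = Z \<and> F \<subseteq> stored w \<and> thick P n w \<ge> k"
          using IH by blast
        then obtain w where w: "w \<in> P" "desc c w" "fst c < fst w" "cand w = Z" "F \<subseteq> stored w"
          "thick P n w \<ge> k" by blast
        have "desc v w" "fst v < fst w"
          using child_desc[OF c(1)] w(3) desc_trans[OF _ w(2), of v] by auto
        then show ?thesis using w by (intro disjI1 bexI[of _ w]) simp_all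
      qed
    qed
  qed
  moreover have "\<not> thick P n c < k" if "child v c" for c
    using thick_child_le[OF that, of P n] th by (cases "v \<in> P") auto
  ultimately show ?thesis by blast
qed

subsection \<open>Embedding graphs of small treewidth\<close>

text \<open>Cleanness is kept because candidates and upper neighbours of a clean node agree; a
  further node can then be proved clean from adjacency in \<open>H\<close>.\<close>

definition embeds :: "'b sgraph \<Rightarrow> node set \<Rightarrow> ('b \<Rightarrow> node) \<Rightarrow> 'b set \<Rightarrow> bool" where
  "embeds H P f A \<longleftrightarrow> inj_on f A \<and> f ` A \<subseteq> P \<and> (\<forall>x\<in>A. clean (f x)) \<and>
     (\<forall>x\<in>A. \<forall>y\<in>A. adj H x y \<longleftrightarrow> ladj (f x) (f y))"

lemma embeds_subset: "\<lbrakk>embeds H P f A; B \<subseteq> A\<rbrakk> \<Longrightarrow> embeds H P f B"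
  unfolding embeds_def by (meson image_mono inj_on_subset order_trans subsetD)

text \<open>The candidates of \<open>w\<close> are the images of the neighbours of \<open>h\<close>.
  An edge between two of them would give a triangle of \<open>H\<close> through \<open>h\<close>, so
  \<open>w\<close> is clean and its upper neighbours are exactly the wanted ones.\<close>

lemma embeds_introduce:
  assumes H: "wf_graph H" "triangle_free H" and emb: "embeds H P f A"
    and A: "insert h A \<subseteq> verts H" "h \<notin> A" "finite A" "card A < s"
    and fA: "f ` A \<subseteq> insert u (stored u)" and th: "thick P n u \<ge> Suc k" "k \<ge> 1"
  shows "\<exists>w. desc u w \<and> fst u < fst w \<and> thick P n w \<ge> k \<and> embeds H P (f(h := w)) (insert h A) \<and>
    f ` A \<subseteq> stored w \<and> cand w \<subseteq> f ` A"
proof -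
  define Z where "Z = f ` {x \<in> A. adj H x h}"
  have "card (f ` A) < s" using A card_image_le[of A f] by simp
  moreover have "Z \<subseteq> f ` A" by (auto simp: Z_def)
  ultimately obtain w where w: "w \<in> P" "desc u w" "fst u < fst w" "cand w = Z" "f ` A \<subseteq> stored w" "thick P n w \<ge> k"
    using thick_introduce[OF fA _ _ _ th, of Z] A(3) by blast
  have inj: "inj_on f A" and fcl: "\<And>x. x \<in> A \<Longrightarrow> clean (f x)"
    and fadj: "\<And>x y. \<lbrakk>x \<in> A; y \<in> A\<rbrakk> \<Longrightarrow> adj H x y \<longleftrightarrow> ladj (f x) (f y)" and fP: "f ` A \<subseteq> P"
    using emb by (auto simp: embeds_def)
  have cl: "clean w"
    unfolding clean_def w(4)
  proof (intro ballI notI)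
    fix a b assume "a \<in> Z" "b \<in> Z" and ab: "a \<in> cand b"
    then obtain x y where x: "x \<in> A" "a = f x" "adj H x h" and y: "y \<in> A" "b = f y" "adj H y h"
      by (auto simp: Z_def)
    have "a \<in> up b" using ab fcl y by (simp add: up_def)
    then have "adj H x y" using fadj x y by (simp add: ladj_def)
    then show False
      using H(2) A(1) x y unfolding triangle_free_def by blast
  qed
  have fw: "fst (f x) < fst w" if "x \<in> A" for x
    using stored_desc w(5) that by blast
  have new: "ladj (f x) w \<longleftrightarrow> adj H x h" if x: "x \<in> A" for x
  proof -
    have "ladj (f x) w \<longleftrightarrow> f x \<in> Z"
      using ladj_below[OF fw[OF x]] cl w(4) by (simp add: up_def)
    also have "\<dots> \<longleftrightarrow> adj H x h" using x inj by (auto simp: Z_def inj_on_eq_iff)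
    finally show ?thesis .
  qed
  have nl: "\<not> adj H h h" using wf_graph_adjD(3)[OF H(1)] by blast
  have "embeds H P (f(h := w)) (insert h A)"
    unfolding embeds_def
  proof (intro conjI ballI)
    have "w \<notin> f ` A" using fw by blast
    then show "inj_on (f(h := w)) (insert h A)"
      using inj A(2) by (auto simp: inj_on_def)
    show "f(h := w) ` insert h A \<subseteq> P" using fP w(1) A(2) by auto
    fix x assume x: "x \<in> insert h A"
    then show "clean ((f(h := w)) x)" using fcl cl by auto
    fix y assume y: "y \<in> insert h A"
    show "adj H x y \<longleftrightarrow> ladj ((f(h := w)) x) ((f(h := w)) y)"
      using x y A(2) fadj[of x y] new[of x] new[of y] nl ladj_irrefl[of w] adj_commute[of H h y]
        ladj_commute[of w "f y"] by auto
  qed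
  then show ?thesis using w \<open>Z \<subseteq> f ` A\<close> by (intro exI[of _ w]) simp
qed

text \<open>Each vertex of \<open>D\<close> costs one unit of thickness. The clause on
  \<open>cand\<close> says that new nodes look only at the image; it later excludes edges to
  vertices embedded elsewhere.\<close>

lemma embeds_introduce_many:
  assumes H: "wf_graph H" "triangle_free H" and "finite D" and emb: "embeds H P f A"
    and "A \<union> D \<subseteq> verts H" "A \<inter> D = {}" "finite A" "card (A \<union> D) < s"
    and "f ` A \<subseteq> insert u (stored u)" "thick P n u \<ge> k + card D" "k \<ge> 1"
  shows "\<exists>w f'. desc u w \<and> thick P n w \<ge> k \<and> (\<forall>x\<in>A. f' x = f x) \<and> embeds H P f' (A \<union> D) \<and>
    f' ` (A \<union> D) \<subseteq> insert w (stored w) \<and>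
    (\<forall>x\<in>D. desc u (f' x) \<and> fst u < fst (f' x) \<and> cand (f' x) \<subseteq> f' ` (A \<union> D))"
  using assms(3-)
proof (induction D arbitrary: A u f rule: finite_induct)
  case empty
  then show ?case by (intro exI[of _ u] exI[of _ f]) simp
next
  case (insert h D)
  have "card A \<le> card (A \<union> insert h D)" using insert.prems insert.hyps by (intro card_mono) auto
  then have "card A < s" using insert.prems by linarith
  then have "\<exists>w. desc u w \<and> fst u < fst w \<and> thick P n w \<ge> k + card D \<and> embeds H P (f(h := w)) (insert h A) \<and>
    f ` A \<subseteq> stored w \<and> cand w \<subseteq> f ` A"
    using insert.prems insert.hyps by (intro embeds_introduce[OF H]) auto
  then obtain v where v: "desc u v" "fst u < fst v" "thick P n v \<ge> k + card D"
      "embeds H P (f(h := v)) (insert h A)" "f ` A \<subseteq> stored v" "cand v \<subseteq> f ` A"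
    by blast
  define f1 where "f1 = f(h := v)"
  define U where "U = A \<union> insert h D"
  have eq: "insert h A \<union> D = U" by (auto simp: U_def)
  have hA: "h \<notin> A" using insert.prems by auto
  have f1: "embeds H P f1 (insert h A)" using v(4) by (simp only: f1_def)
  have img: "f1 ` insert h A \<subseteq> insert v (stored v)"
    using v(5) by (auto simp: f1_def)
  have "\<exists>w f'. desc v w \<and> thick P n w \<ge> k \<and> (\<forall>x\<in>insert h A. f' x = f1 x) \<and>
    embeds H P f' U \<and> f' ` U \<subseteq> insert w (stored w) \<and>
    (\<forall>x\<in>D. desc v (f' x) \<and> fst v < fst (f' x) \<and> cand (f' x) \<subseteq> f' ` U)"
    unfolding eq[symmetric]
  proof (rule insert.IH[OF f1 _ _ _ _ img v(3)])
    show "insert h A \<union> D \<subseteq> verts H" "card (insert h A \<union> D) < s"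
      using insert.prems(2,5) by (simp_all only: eq U_def)
    show "insert h A \<inter> D = {}" using insert.prems(3) insert.hyps by auto
  qed (use insert.prems in simp_all)
  then obtain w f' where w: "desc v w" "thick P n w \<ge> k" "\<And>x. x \<in> insert h A \<Longrightarrow> f' x = f1 x"
    "embeds H P f' U" "f' ` U \<subseteq> insert w (stored w)"
    and D: "\<And>x. x \<in> D \<Longrightarrow> desc v (f' x) \<and> fst v < fst (f' x) \<and> cand (f' x) \<subseteq> f' ` U"
    by metis
  have fA: "f' x = f x" if "x \<in> A" for x using w(3)[of x] that hA by (auto simp: f1_def)
  have fh: "f' h = v" using w(3)[of h] by (simp add: f1_def)
  have "f' ` A = f ` A" using fA by (intro image_cong) auto
  have new: "desc u (f' x) \<and> fst u < fst (f' x) \<and> cand (f' x) \<subseteq> f' ` U"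
    if "x \<in> insert h D" for x
  proof (cases "x = h")
    case True
    have "cand v \<subseteq> f' ` U" using v(6) \<open>f' ` A = f ` A\<close> by (auto simp: U_def)
    then show ?thesis using True v fh by simp
  next
    case False
    then have "x \<in> D" using that by simp
    then show ?thesis using D[of x] v(2) desc_trans[OF v(1), of "f' x"] by auto
  qed
  show ?case
    unfolding U_def[symmetric]
    using w(2,4,5) desc_trans[OF v(1) w(1)] fA new by (intro exI[of _ w] exI[of _ f']) simp
qed

lemma div_near:
  fixes a b m :: int
  assumes "\<bar>a - b\<bar> = 1" "m > 0"
  shows "\<bar>a div m - b div m\<bar> \<le> 1"
proof -
  have *: "x div m \<le> (x + 1) div m \<and> (x + 1) div m \<le> x div m + 1" for x
  proof
    show "x div m \<le> (x + 1) div m" using assms(2) by (intro zdiv_mono1) auto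
    have "(x + 1) div m \<le> (x + m) div m" using assms(2) by (intro zdiv_mono1) auto
    then show "(x + 1) div m \<le> x div m + 1" using assms(2) div_add_self2[of m x] by simp
  qed
  have "a = b + 1 \<or> b = a + 1" using assms(1) by linarith
  then show ?thesis using *[of a] *[of b] by auto
qed

text \<open>Neighbours in a layer have ancestors at distance at most 1 in every earlier layer, and
  all other edges join a node to one of its ancestors. So no edge runs between the descendants of
  \<open>c\<close> and those of \<open>d\<close>.\<close>

lemma desc_apart:
  assumes lev: "fst c = fst d" and far: "2 \<le> \<bar>snd c - snd d\<bar>" and x: "desc c x" and y: "desc d y"
  shows "x \<noteq> y" "\<not> ladj x y"
proof -
  have ne: "c \<noteq> d" using far by auto
  have disj: False if "desc c z" "desc d z" for z
    using desc_linear[OF that] desc_same_level[of c d] lev ne by simp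
  show "x \<noteq> y" using disj x y by blast
  show "\<not> ladj x y"
  proof
    assume "ladj x y"
    then consider "fst x = fst y" "\<bar>snd x - snd y\<bar> = 1" | "x \<in> up y" | "y \<in> up x"
      by (auto simp: ladj_def)
    then show False
    proof cases
      case 1
      have "0 < M ^ (fst x - fst c)" using M_gt_1 by simp
      then have "\<bar>snd x div M ^ (fst x - fst c) - snd y div M ^ (fst x - fst c)\<bar> \<le> 1"
        using 1(2) by (intro div_near)
      then show False using x y 1(1) lev far by (simp add: desc_def)
    next
      case 2
      then show False using disj up_desc[of x y] desc_trans[OF x, of y] y by blast
    next
      case 3
      then show False using disj up_desc[of y x] desc_trans[OF y, of x] x by blast
    qed
  qed
qed

text \<open>At a join, \<open>N\<close> continues below \<open>d\<close> and \<open>N'\<close> below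
  \<open>e\<close>, two children of \<open>u\<close> at distance at least 2 that both remember
  \<open>bag r\<close>. Before \<open>N'\<close> can continue, the vertices of \<open>bag c\<close>
  outside \<open>bag r\<close> are introduced below \<open>e\<close>. Branching costs one unit of
  thickness and these introductions at most \<open>s\<close>, whence the factor
  \<open>s + 1\<close>.\<close>

lemma embeds_rooted_td:
  assumes H: "wf_graph H" "triangle_free H" and "rooted_td bag r N"
    and "\<And>i. i \<in> N \<Longrightarrow> bag i \<subseteq> verts H \<and> card (bag i) < s"
    and "\<And>x y. \<lbrakk>x \<in> \<Union> (bag ` N); y \<in> \<Union> (bag ` N); adj H x y\<rbrakk> \<Longrightarrow> \<exists>i\<in>N. x \<in> bag i \<and> y \<in> bag i"
    and "thick P n u \<ge> (s + 1) * card N" "embeds H P f (bag r)" "f ` bag r \<subseteq> insert u (stored u)"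
  shows "\<exists>f'. (\<forall>x\<in>bag r. f' x = f x) \<and> embeds H P f' (\<Union> (bag ` N)) \<and>
    (\<forall>x\<in>\<Union> (bag ` N) - bag r. desc u (f' x) \<and> fst u < fst (f' x) \<and> cand (f' x) \<subseteq> f' ` \<Union> (bag ` N))"
  using assms(3-)
proof (induction arbitrary: u f rule: rooted_td.induct)
  case (single r)
  then show ?case by (intro exI[of _ f]) simp
next
  case (join r N c N')
  let ?A = "bag r \<inter> bag c"
  define V W where V: "V = \<Union> (bag ` N)" and W: "W = \<Union> (bag ` N')"
  have UVW: "\<Union> (bag ` (N \<union> N')) = V \<union> W" by (auto simp: V W)
  have edge: "\<exists>i\<in>N \<union> N'. x \<in> bag i \<and> y \<in> bag i" if "x \<in> V \<union> W" "y \<in> V \<union> W" "adj H x y" for x y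
    using join.prems(2)[of x y] that unfolding UVW by blast
  have rN: "r \<in> N" and cN': "c \<in> N'" using join.hyps rooted_td_root by auto
  have finN: "finite N" "finite N'" using join.hyps rooted_td_finite by auto
  have sub: "bag i \<subseteq> verts H" "card (bag i) < s" if "i \<in> N \<union> N'" for i
    using join.prems(1)[OF that] by auto
  have finb: "finite (bag i)" if "i \<in> N \<union> N'" for i
    using sub(1)[OF that] H(1) by (auto simp: wf_graph_def intro: finite_subset)
  have VW: "V \<inter> W \<subseteq> ?A" unfolding V W by (rule join.hyps)
  have AV: "bag r \<subseteq> V" "bag c \<subseteq> W" using rN cN' by (auto simp: V W)
  have cards: "card N \<ge> 1" "card N' \<ge> 1" "card (N \<union> N') = card N + card N'"
    using finN rN cN' join.hyps(3) by (auto simp: card_gt_0_iff Suc_le_eq card_Un_disjoint)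
  have "card (f ` bag r) < s" using card_image_le[OF finb, of r f] sub(2)[of r] rN by simp
  then obtain d e where d: "child u d" "f ` bag r \<subseteq> stored d" and e: "child u e" "f ` bag r \<subseteq> stored e"
    and far: "2 \<le> \<bar>snd d - snd e\<bar>"
    using two_children[OF join.prems(5)] finb rN by (metis Un_iff finite_imageI)
  have thick_ge: "thick P n u \<ge> (s + 1) * card N + (s + 1) * card N'"
    using join.prems(3) cards(3) by (simp only: distrib_left)
  have ge: "(s + 1) * card N \<ge> s + 1" "(s + 1) * card N' \<ge> s + 1" using mult_le_mono2[OF cards(1), of "s + 1"] mult_le_mono2[OF cards(2), of "s + 1"]
    by simp_all
  have le1: "thick P n u \<le> 1 + thick P n v" if "child u v" for v
    using thick_child_le[OF that, of P n] by (cases "u \<in> P") auto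
  have dthick: "thick P n d \<ge> (s + 1) * card N"
    using le1[OF d(1)] thick_ge ge by linarith
  \<comment> \<open>As \<open>N\<close> is nonempty, its share of at least \<open>s + 1\<close>
    covers the unit lost by branching and leaves \<open>s\<close> units for the new vertices of
    \<open>bag c\<close>.\<close>
  have ethick: "thick P n e \<ge> (s + 1) * card N' + s"
    using le1[OF e(1)] thick_ge ge by linarith
  have "\<exists>f'. (\<forall>x\<in>bag r. f' x = f x) \<and> embeds H P f' V \<and>
    (\<forall>x\<in>V - bag r. desc d (f' x) \<and> fst d < fst (f' x) \<and> cand (f' x) \<subseteq> f' ` V)"
    unfolding V
  proof (rule join.IH(1)[OF _ _ dthick join.prems(4)])
    show "bag i \<subseteq> verts H \<and> card (bag i) < s" if "i \<in> N" for i using sub[of i] that by simp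
    fix x y assume "x \<in> \<Union> (bag ` N)" "y \<in> \<Union> (bag ` N)" and a: "adj H x y"
    then have xy: "x \<in> V" "y \<in> V" by (simp_all only: V)
    then obtain i where i: "i \<in> N \<union> N'" "x \<in> bag i" "y \<in> bag i" using edge[of x y] a by auto
    show "\<exists>i\<in>N. x \<in> bag i \<and> y \<in> bag i"
    \<comment> \<open>An edge within \<open>V\<close> that is covered by a bag of \<open>N'\<close>
      has both ends in \<open>V \<inter> W\<close>, hence in \<open>bag r\<close>.\<close>
    proof (cases "i \<in> N")
      case False
      then have "i \<in> N'" using i by blast
      then have "x \<in> ?A" "y \<in> ?A" using i xy VW by (auto simp: V W)
      then show ?thesis using rN by blast
    qed (use i in blast)
  qed (use d in blast)
  then obtain f1 where f1r: "\<And>x. x \<in> bag r \<Longrightarrow> f1 x = f x" and f1: "embeds H P f1 V"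
    and f1new: "\<And>x. x \<in> V - bag r \<Longrightarrow> desc d (f1 x) \<and> fst d < fst (f1 x) \<and> cand (f1 x) \<subseteq> f1 ` V"
    by metis
  have Ac: "?A \<union> (bag c - bag r) = bag c" by auto
  have "card (bag c - bag r) \<le> s"
    using card_mono[of "bag c" "bag c - bag r"] finb[of c] sub(2)[of c] cN' by simp
  moreover have "embeds H P f ?A" using join.prems(4) by (rule embeds_subset) simp
  moreover have "f ` ?A \<subseteq> insert e (stored e)" using e(2) by blast
  ultimately have "\<exists>w g. desc e w \<and> thick P n w \<ge> (s + 1) * card N' \<and> (\<forall>x\<in>?A. g x = f x) \<and>
    embeds H P g (?A \<union> (bag c - bag r)) \<and> g ` (?A \<union> (bag c - bag r)) \<subseteq> insert w (stored w) \<and>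
    (\<forall>x\<in>bag c - bag r. desc e (g x) \<and> fst e < fst (g x) \<and> cand (g x) \<subseteq> g ` (?A \<union> (bag c - bag r)))"
    using ethick ge(2) sub[of c] finb[of c] cN' by (intro embeds_introduce_many[OF H]) (auto simp: Ac)
  then obtain w g where w: "desc e w" "thick P n w \<ge> (s + 1) * card N'" and gA: "\<And>x. x \<in> ?A \<Longrightarrow> g x = f x"
    and g: "embeds H P g (bag c)" "g ` bag c \<subseteq> insert w (stored w)"
    and gnew: "\<And>x. x \<in> bag c - bag r \<Longrightarrow> desc e (g x) \<and> fst e < fst (g x) \<and> cand (g x) \<subseteq> g ` bag c"
    unfolding Ac by metis
  have "\<exists>f'. (\<forall>x\<in>bag c. f' x = g x) \<and> embeds H P f' W \<and>
    (\<forall>x\<in>W - bag c. desc w (f' x) \<and> fst w < fst (f' x) \<and> cand (f' x) \<subseteq> f' ` W)"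
    unfolding W
  proof (rule join.IH(2)[OF _ _ w(2) g])
    show "bag i \<subseteq> verts H \<and> card (bag i) < s" if "i \<in> N'" for i using sub[of i] that by simp
    fix x y assume "x \<in> \<Union> (bag ` N')" "y \<in> \<Union> (bag ` N')" and a: "adj H x y"
    then have xy: "x \<in> W" "y \<in> W" by (simp_all only: W)
    then obtain i where i: "i \<in> N \<union> N'" "x \<in> bag i" "y \<in> bag i" using edge[of x y] a by auto
    show "\<exists>i\<in>N'. x \<in> bag i \<and> y \<in> bag i"
    proof (cases "i \<in> N'")
      case False
      then have "i \<in> N" using i by blast
      then have "x \<in> ?A" "y \<in> ?A" using i xy VW by (auto simp: V W)
      then show ?thesis using cN' by blast
    qed (use i in blast)
  qed
  then obtain f2 where f2c: "\<And>x. x \<in> bag c \<Longrightarrow> f2 x = g x" and f2: "embeds H P f2 W"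
    and f2w: "\<And>x. x \<in> W - bag c \<Longrightarrow> desc w (f2 x) \<and> fst w < fst (f2 x) \<and> cand (f2 x) \<subseteq> f2 ` W"
    by metis
  have f2new: "desc e (f2 y) \<and> fst e < fst (f2 y) \<and> cand (f2 y) \<subseteq> f2 ` W" if y: "y \<in> W - V" for y
  proof (cases "y \<in> bag c")
    case True
    have "g ` bag c = f2 ` bag c" using f2c by (intro image_cong) auto
    then have "g ` bag c \<subseteq> f2 ` W" using AV by auto
    moreover have "y \<in> bag c - bag r" using True y AV by blast
    ultimately show ?thesis using gnew[of y] f2c[OF True] by auto
  next
    case False
    then show ?thesis using f2w[of y] y w(1) desc_trans[OF w(1), of "f2 y"] by (auto simp: desc_def)
  qed
  have f2A: "f2 x = f x" if "x \<in> ?A" for x using f2c[of x] gA[OF that] that by simp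
  have eu: "fst e = Suc (fst u)" "fst d = Suc (fst u)" using d(1) e(1) by (auto simp: child_def)
  define h where "h x = (if x \<in> V then f1 x else f2 x)" for x
  have hV: "h x = f1 x" if "x \<in> V" for x using that by (simp add: h_def)
  have hW: "h x = f2 x" if "x \<in> W" for x
  proof (cases "x \<in> V")
    case True
    then have "x \<in> ?A" using that VW by blast
    then show ?thesis using f2A[of x] f1r[of x] hV[OF True] by simp
  qed (simp add: h_def)
  have cross: "h x \<noteq> h y \<and> \<not> ladj (h x) (h y) \<and> \<not> adj H x y" if x: "x \<in> V - W" and y: "y \<in> W - V" for x y
  proof -
    have "\<not> adj H x y"
      using edge[of x y] x y by (auto simp: V W)
    moreover have "h x \<noteq> h y \<and> \<not> ladj (h x) (h y)"
    \<comment> \<open>The image of a vertex of \<open>bag r\<close> does not lie below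
      \<open>d\<close>, so distance is of no help. It lies in an earlier layer than
      \<open>f2 y\<close>, so an edge would make it a candidate of \<open>f2 y\<close>; but these
      candidates are images of \<open>W\<close>, and \<open>x\<close> is not in
      \<open>W\<close>.\<close>
    proof (cases "x \<in> bag r")
      case True
      have "f x \<in> insert u (stored u)" using True join.prems(5) by blast
      then have fx: "fst (f x) \<le> fst u" using stored_desc[of "f x" u] by auto
      have lt: "fst (f x) < fst (f2 z)" if "z \<in> W - V" for z using f2new[OF that] fx eu by auto
      have "f x \<notin> cand (f2 y)"
      proof
        assume "f x \<in> cand (f2 y)"
        then obtain z where z: "z \<in> W" "f x = f2 z" using f2new[OF y] by blast
        show False
        proof (cases "z \<in> V")
          case True': True
          then have "z \<in> ?A" using z VW by blast
          then have "f x = f z" using z f2A by simp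
          then have "x = z"
            using join.prems(4) True \<open>z \<in> ?A\<close> by (auto simp: embeds_def inj_on_def)
          then show False using x z by blast
        next
          case False
          then show False using lt[of z] z by simp
        qed
      qed
      then have "\<not> ladj (f x) (f2 y)" using ladj_below[OF lt[OF y]] up_cand by blast
      moreover have "h x = f x" "h y = f2 y" using hV hW f1r True x y by auto
      ultimately show ?thesis using lt[OF y] by auto
    next
      case False
      then have "desc d (f1 x)" "desc e (f2 y)" using f1new[of x] f2new[of y] x y by auto
      then show ?thesis using desc_apart[OF _ far] eu hV hW x y by simp
    qed
    ultimately show ?thesis by blast
  qed
  have hadj: "(h x = h y \<longrightarrow> x = y) \<and> (adj H x y \<longleftrightarrow> ladj (h x) (h y))" if xy: "x \<in> V \<union> W" "y \<in> V \<union> W" for x y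
  proof -
    have inV: ?thesis if "x \<in> V" "y \<in> V"
      using f1 that hV unfolding embeds_def by (auto simp: inj_on_eq_iff)
    have inW: ?thesis if "x \<in> W" "y \<in> W"
      using f2 that hW unfolding embeds_def by (auto simp: inj_on_eq_iff)
    consider "x \<in> V" "y \<in> V" | "x \<in> W" "y \<in> W" | "x \<in> V - W" "y \<in> W - V" | "y \<in> V - W" "x \<in> W - V"
      using xy by blast
    then show ?thesis
    proof cases
      case 3
      then show ?thesis using cross by blast
    next
      case 4
      then show ?thesis using cross[OF 4] adj_commute[of H x y] ladj_commute[of "h x" "h y"] by auto
    qed (use inV inW in blast)+
  qed
  have "embeds H P h (V \<union> W)"
    unfolding embeds_def
  proof (intro conjI ballI)
    show "inj_on h (V \<union> W)" using hadj by (intro inj_onI) blast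
    show "h ` (V \<union> W) \<subseteq> P"
    proof
      fix z assume "z \<in> h ` (V \<union> W)"
      then consider x where "x \<in> V" "z = f1 x" | x where "x \<in> W" "z = f2 x" using hV hW by blast
      then show "z \<in> P" using f1 f2 unfolding embeds_def by cases blast+
    qed
    show "clean (h x)" if "x \<in> V \<union> W" for x
      using that f1 f2 hV[of x] hW[of x] unfolding embeds_def by auto
  qed (use hadj in blast)
  moreover have "desc u (h x) \<and> fst u < fst (h x) \<and> cand (h x) \<subseteq> h ` (V \<union> W)"
    if x: "x \<in> (V \<union> W) - bag r" for x
  proof (cases "x \<in> V")
    case True
    have "f1 ` V = h ` V" using hV by (intro image_cong) auto
    then show ?thesis
      using f1new[of x] x True hV[OF True] child_desc[OF d(1)] desc_trans[of u d "h x"] by auto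
  next
    case False
    then have xW: "x \<in> W - V" using x by blast
    have "f2 ` W = h ` W" using hW by (intro image_cong) auto
    then show ?thesis
      using f2new[OF xW] xW hW[of x] child_desc[OF e(1)] desc_trans[of u e "h x"] by auto
  qed
  moreover have "h x = f x" if "x \<in> bag r" for x
    using hV[of x] f1r[OF that] that AV by auto
  ultimately show ?case unfolding UVW by (intro exI[of _ h]) simp
qed

text \<open>Every bag has at most \<open>t + 1 < s\<close> vertices. Placing the root bag costs at
  most \<open>s\<close>, after which the recursion over the decomposition takes over. The bound
  \<open>K\<close> does not depend on \<open>P\<close>.\<close>

lemma thick_embeds:
  assumes H: "wf_graph H" "triangle_free H" and tw: "treewidth_le H t" and t: "t + 2 \<le> s"
  shows "\<exists>K. \<forall>P n u. K \<le> thick P n u \<longrightarrow> (\<exists>f. embeds H P f (verts H))"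
proof -
  obtain T bag where td: "tree_decomposition H T bag" and w: "\<And>i. i \<in> verts T \<Longrightarrow> card (bag i) \<le> t + 1"
    using tw unfolding treewidth_le_def by blast
  have T: "is_tree T" and sub: "\<And>i. i \<in> verts T \<Longrightarrow> bag i \<subseteq> verts H"
    and cov: "\<And>v. v \<in> verts H \<Longrightarrow> \<exists>i\<in>verts T. v \<in> bag i"
    and edg: "\<And>u v. \<lbrakk>u \<in> verts H; v \<in> verts H; adj H u v\<rbrakk> \<Longrightarrow> \<exists>i\<in>verts T. u \<in> bag i \<and> v \<in> bag i"
    and con: "\<And>v. v \<in> verts H \<Longrightarrow> connected_on T {i\<in>verts T. v \<in> bag i}"
    using td by (auto simp: tree_decomposition_def)
  have "connected_on T {i\<in>verts T. v \<in> bag i}" for v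
  proof (cases "v \<in> verts H")
    case False
    then have "{i\<in>verts T. v \<in> bag i} = {}" using sub by blast
    then show ?thesis by (simp only: connected_on_def) simp
  qed (rule con)
  then obtain r where r: "rooted_td bag r (verts T)" using rooted_td_exists[OF T] by blast
  have rT: "r \<in> verts T" by (rule rooted_td_root[OF r])
  have V: "\<Union> (bag ` verts T) = verts H" using sub cov by blast
  let ?k = "(s + 1) * card (verts T)"
  have "\<exists>f. embeds H P f (verts H)" if th: "?k + s \<le> thick P n u" for P n u
  proof -
    have card_r: "card (bag r) < s" using w[OF rT] t by simp
    have "?k \<ge> 1" using rT rooted_td_finite[OF r] by (auto simp: Suc_le_eq card_gt_0_iff)
    moreover have "?k + card (bag r) \<le> thick P n u" using th card_r by linarith
    moreover have "finite (bag r)" using sub[OF rT] H(1) by (auto simp: wf_graph_def intro: finite_subset)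
    moreover have "embeds H P (\<lambda>_. u) {}" by (simp add: embeds_def)
    ultimately have "\<exists>w f'. desc u w \<and> thick P n w \<ge> ?k \<and> (\<forall>x\<in>{}. f' x = u) \<and> embeds H P f' ({} \<union> bag r) \<and>
      f' ` ({} \<union> bag r) \<subseteq> insert w (stored w) \<and>
      (\<forall>x\<in>bag r. desc u (f' x) \<and> fst u < fst (f' x) \<and> cand (f' x) \<subseteq> f' ` ({} \<union> bag r))"
      using sub[OF rT] card_r by (intro embeds_introduce_many[OF H]) auto
    then obtain v f where v: "thick P n v \<ge> ?k" "embeds H P f (bag r)" "f ` bag r \<subseteq> insert v (stored v)"
      by auto
    have "\<exists>f'. (\<forall>x\<in>bag r. f' x = f x) \<and> embeds H P f' (\<Union> (bag ` verts T)) \<and>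
      (\<forall>x\<in>\<Union> (bag ` verts T) - bag r. desc v (f' x) \<and> fst v < fst (f' x) \<and>
        cand (f' x) \<subseteq> f' ` \<Union> (bag ` verts T))"
    proof (rule embeds_rooted_td[OF H r _ _ v])
      show "bag i \<subseteq> verts H \<and> card (bag i) < s" if "i \<in> verts T" for i
        using sub[OF that] w[OF that] t by simp
    qed (use edg in \<open>simp add: V\<close>)
    then show ?thesis unfolding V by blast
  qed
  then show ?thesis by blast
qed

subsection \<open>Bounding the treewidth by the thickness\<close>

text \<open>Each node takes a child attaining the minimum in \<open>thick\<close>; from layer
  \<open>n\<close> on, where \<open>P\<close> has no nodes, any child will do. With one successor
  function for all nodes, two paths are disjoint or nested, so they can serve as boundaries.\<close>

lemma thin_paths:
  assumes n: "\<And>x. x \<in> P \<Longrightarrow> fst x < n"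
  obtains nxt where "\<And>u. child u (nxt u)" "\<And>u. card (P \<inter> range (\<lambda>i. (nxt ^^ i) u)) \<le> thick P n u"
proof -
  have "\<exists>c. child u c \<and> (fst u < n \<longrightarrow> thick P n u = of_bool (u \<in> P) + thick P n c)" for u
  proof (cases "fst u < n")
    case True
    then show ?thesis using thick_child_eq[OF True, where P = P] by metis
  next
    case False
    then show ?thesis using children_nonempty[of u] by blast
  qed
  then obtain nxt where nxt: "\<And>u. child u (nxt u)"
    "\<And>u. fst u < n \<Longrightarrow> thick P n u = of_bool (u \<in> P) + thick P n (nxt u)" by metis
  define fw where "fw u = range (\<lambda>i. (nxt ^^ i) u)" for u
  have lev: "fst ((nxt ^^ i) u) = fst u + i" for i u
    using nxt(1) by (induction i) (auto simp: child_def)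
  have fw_step: "fw u = insert u (fw (nxt u))" for u
  proof
    show "fw u \<subseteq> insert u (fw (nxt u))"
    proof
      fix x assume "x \<in> fw u"
      then obtain i where i: "x = (nxt ^^ i) u" by (auto simp: fw_def)
      show "x \<in> insert u (fw (nxt u))"
      proof (cases i)
        case (Suc i')
        then have "x = (nxt ^^ i') (nxt u)" using i by (simp add: funpow_swap1)
        then show ?thesis by (simp add: fw_def)
      qed (use i in simp)
    qed
    have "(nxt ^^ 0) u \<in> fw u" "(nxt ^^ i) (nxt u) \<in> fw u" for i
      unfolding fw_def by (rule rangeI, rule range_eqI[of _ _ "Suc i"]) (simp add: funpow_swap1)
    then show "insert u (fw (nxt u)) \<subseteq> fw u" by (auto simp: fw_def)
  qed
  have "finite (P \<inter> fw u) \<and> card (P \<inter> fw u) \<le> thick P n u" for u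
  proof (induction "n - fst u" arbitrary: u)
    case 0
    have "x \<notin> P" if "x \<in> fw u" for x
    proof -
      from that obtain i where "x = (nxt ^^ i) u" by (auto simp: fw_def)
      then have "n \<le> fst x" using 0 lev[of i u] by simp
      then show ?thesis using n[of x] by auto
    qed
    then have "P \<inter> fw u = {}" by blast
    then show ?case by simp
  next
    case (Suc m)
    have "m = n - fst (nxt u)" using Suc.hyps(2) nxt(1)[of u] by (simp add: child_def)
    then have IH: "finite (P \<inter> fw (nxt u))" "card (P \<inter> fw (nxt u)) \<le> thick P n (nxt u)"
      using Suc.hyps(1)[of "nxt u"] by auto
    have "thick P n u = of_bool (u \<in> P) + thick P n (nxt u)" using nxt(2)[of u] Suc.hyps(2) by simp
    moreover have "P \<inter> fw u = (if u \<in> P then insert u (P \<inter> fw (nxt u)) else P \<inter> fw (nxt u))"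
      using fw_step[of u] by auto
    ultimately show ?case using IH by (auto simp: card_insert_if)
  qed
  then show thesis using that[of nxt] nxt(1) unfolding fw_def by metis
qed

text \<open>The paths \<open>u, nxt u, nxt (nxt u), \<dots>\<close> cut each layer into gaps, and a gap is contained in a gap of
  the preceding layer. The gaps are the nodes of the decomposition tree; the gap \<open>(l, g)\<close> lies in layer
  \<open>l + 1\<close> between the paths through \<open>(l, g)\<close> and \<open>(l, g + 1)\<close>.\<close>

lemma treewidth_thin_paths:
  fixes f :: "'a \<Rightarrow> node"
  assumes wf: "wf_graph G" and f: "inj_on f (verts G)" and pos: "\<And>v. v \<in> verts G \<Longrightarrow> 0 < fst (f v)"
    and fadj: "\<And>u v. \<lbrakk>u \<in> verts G; v \<in> verts G\<rbrakk> \<Longrightarrow> adj G u v \<longleftrightarrow> ladj (f u) (f v)"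
    and nxt: "\<And>u. child u (nxt u)"
    and thin: "\<And>u. card (f ` verts G \<inter> range (\<lambda>i. (nxt ^^ i) u)) \<le> K"
  shows "treewidth_le G (2 * nat M * (K + s))"
proof -
  define P where "P = f ` verts G"
  define fw where "fw u = range (\<lambda>i. (nxt ^^ i) u)" for u
  define nx where "nx l g = snd (nxt (l, g))" for l g
  have finP: "finite P" using wf by (simp add: P_def wf_graph_def)
  have nxt_eq: "nxt (l, g) = (Suc l, nx l g)" for l g
    using nxt[of "(l, g)"] by (simp add: child_def nx_def prod_eq_iff)
  have nx_div: "nx l g div M = g" for l g
    using nxt[of "(l, g)"] by (simp add: child_def nx_def)
  have lev: "fst ((nxt ^^ i) u) = fst u + i" for i u
    using nxt by (induction i) (auto simp: child_def)
  \<comment> \<open>Paths do not cross: the children of \<open>g\<close> precede those of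
    \<open>g'\<close>.\<close>
  have nx_less: "nx l g < nx l g'" if "g < g'" for l g g'
  proof (rule ccontr)
    assume "\<not> nx l g < nx l g'"
    then have "nx l g' div M \<le> nx l g div M" using M_gt_1 by (intro zdiv_mono1) auto
    then show False using that nx_div by simp
  qed
  have nx_le: "nx l g \<le> nx l g'" if "g \<le> g'" for l g g'
    using nx_less[of g g' l] that by (cases "g = g'") auto
  have fw_self: "u \<in> fw u" for u unfolding fw_def by (rule range_eqI[of _ _ 0]) simp
  have fw_nxt: "x \<in> fw u" if x: "x \<in> fw (nxt u)" for x u
  proof -
    obtain i where "x = (nxt ^^ i) (nxt u)" using x by (auto simp: fw_def)
    then show ?thesis unfolding fw_def by (intro range_eqI[of _ _ "Suc i"]) (simp add: funpow_swap1)
  qed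
  have fw_desc: "desc u x" if x: "x \<in> fw u" for x u
  proof -
    have "desc u ((nxt ^^ i) u)" for i
      by (induction i) (use nxt child_desc desc_trans in auto)
    then show ?thesis using x by (auto simp: fw_def)
  qed

  \<comment> \<open>The path through the parent of \<open>i\<close> splits the siblings of
    \<open>i\<close>. To its left, \<open>i\<close> belongs to the gap that starts at the path
    through the preceding node of layer \<open>l\<close>.\<close>
  define gap where "gap l i = (if nx l (i div M) \<le> i then i div M else i div M - 1)" for l i
  have gap: "nx l (gap l i) \<le> i \<and> i < nx l (gap l i + 1)" for l i
  proof -
    have "i < nx l (i div M + 1)"
      using nx_div[of l "i div M + 1"] zdiv_mono1[of "nx l (i div M + 1)" i M] M_gt_1 by fastforce
    moreover have "nx l (i div M - 1) < i"
      using nx_div[of l "i div M - 1"] zdiv_mono1[of i "nx l (i div M - 1)" M] M_gt_1 by fastforce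
    ultimately show ?thesis by (auto simp: gap_def)
  qed
  have gap_unique: "g = gap l i" if g: "nx l g \<le> i" "i < nx l (g + 1)" for l i g
  proof (rule ccontr)
    assume "g \<noteq> gap l i"
    then consider "g + 1 \<le> gap l i" | "gap l i + 1 \<le> g" by linarith
    then show False
    proof cases
      case 1
      then show False using nx_le[OF 1, of l] gap[of l i] g by linarith
    next
      case 2
      then show False using nx_le[OF 2, of l] gap[of l i] g by linarith
    qed
  qed

  \<comment> \<open>Both ends are included, so that every edge of a layer lies in some gap. Only
    children of \<open>g\<close> and \<open>g + 1\<close> occur, hence the factor
    \<open>2 * nat M\<close>.\<close>
  define I where "I l g = {nx l g..nx l (g + 1)}" for l g
  have I_div: "i div M = g \<or> i div M = g + 1" if "i \<in> I l g" for i l g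
  proof -
    have "nx l g div M \<le> i div M" "i div M \<le> nx l (g + 1) div M"
      using that M_gt_1 by (auto simp: I_def intro!: zdiv_mono1)
    then show ?thesis using nx_div by auto
  qed
  have I_card: "finite (I l g)" "card (I l g) \<le> 2 * nat M" for l g
  proof -
    show "finite (I l g)" by (simp add: I_def)
    have "I l g \<subseteq> {g * M..<g * M + 2 * M}"
    proof
      fix i assume "i \<in> I l g"
      then have "i div M * M = g * M \<or> i div M * M = g * M + M"
        using I_div[of i l g] by (auto simp: distrib_right)
      moreover have "i div M * M + i mod M = i" "0 \<le> i mod M" "i mod M < M"
        using M_gt_1 by simp_all
      ultimately show "i \<in> {g * M..<g * M + 2 * M}" unfolding atLeastLessThan_iff by linarith
    qed
    then have "card (I l g) \<le> card {g * M..<g * M + 2 * M}" by (intro card_mono) auto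
    then show "card (I l g) \<le> 2 * nat M" by (simp add: nat_mult_distrib)
  qed

  \<comment> \<open>A node on a bounding path borders gaps on both sides, which in general meet in
    the tree only where the path starts. So a bag holds all nodes of \<open>P\<close> further down
    the paths through its positions, at most \<open>K\<close> for each, besides at most
    \<open>s\<close> remembered ones.\<close>
  define X where "X q = P \<inter> (\<Union>i\<in>I (fst q) (snd q). fw (Suc (fst q), i) \<union> stored (Suc (fst q), i))" for q
  have X_card: "card (X q) \<le> 2 * nat M * (K + s)" for q
  proof -
    let ?B = "\<lambda>i. P \<inter> (fw (Suc (fst q), i) \<union> stored (Suc (fst q), i))"
    have B: "card (?B i) \<le> K + s" for i
    proof -
      have "?B i \<subseteq> (P \<inter> fw (Suc (fst q), i)) \<union> stored (Suc (fst q), i)" by blast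
      then have "card (?B i) \<le> card ((P \<inter> fw (Suc (fst q), i)) \<union> stored (Suc (fst q), i))"
        using finP stored_card(1) by (intro card_mono) auto
      also have "\<dots> \<le> card (P \<inter> fw (Suc (fst q), i)) + card (stored (Suc (fst q), i))"
        by (rule card_Un_le)
      also have "\<dots> \<le> K + s"
        using thin[of "(Suc (fst q), i)"] stored_card(2) by (intro add_mono) (simp_all add: P_def fw_def)
      finally show ?thesis .
    qed
    have "X q = (\<Union>i\<in>I (fst q) (snd q). ?B i)" by (auto simp: X_def)
    then have "card (X q) \<le> (\<Sum>i\<in>I (fst q) (snd q). card (?B i))"
      using card_UN_le[OF I_card(1)[of "fst q" "snd q"], of ?B] by (simp only:)
    also have "\<dots> \<le> (\<Sum>i\<in>I (fst q) (snd q). K + s)" by (rule sum_mono) (rule B)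
    also have "\<dots> \<le> 2 * nat M * (K + s)"
      using mult_le_mono1[OF I_card(2)[of "fst q" "snd q"], of "K + s"]
      by (simp only: sum_constant of_nat_id)
    finally show ?thesis .
  qed

  obtain n where n: "\<And>x. x \<in> P \<Longrightarrow> fst x \<le> n"
    using finite_nat_set_iff_bounded_le[of "fst ` P"] finP by auto
  obtain N0 where N0: "\<And>x. x \<in> P \<Longrightarrow> nat \<bar>snd x\<bar> \<le> N0"
    using finite_nat_set_iff_bounded_le[of "(\<lambda>x. nat \<bar>snd x\<bar>) ` P"] finP by auto
  define N where "N = int N0 + 3"
  have N: "\<bar>snd x\<bar> < N" if "x \<in> P" for x using N0[OF that] by (simp add: N_def)
  have N3: "3 \<le> N" by (simp add: N_def)
  \<comment> \<open>Division by \<open>M\<close> at least halves a negative position, which makes up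
    for the possible shift of \<open>gap\<close> by one to the left; the summand 3 in
    \<open>N\<close> gives room for this.\<close>
  have gap_bound: "-N \<le> gap l i \<and> gap l i \<le> N" if i: "-N \<le> i" "i \<le> N" for l i
  proof (cases "i \<ge> 0")
    case True
    then have "0 \<le> i div M" "i div M \<le> i"
      using M_gt_1 by (auto simp: pos_imp_zdiv_nonneg_iff int_div_less_self div_by_1 intro: zdiv_mono2[of i 1 M, simplified])
    then show ?thesis using i N3 by (auto simp: gap_def)
  next
    case False
    then have "i div 2 \<le> i div M" using M_gt_1 by (intro zdiv_mono2_neg) auto
    moreover have "-N \<le> i div 2 - 1" using i N3 by presburger
    moreover have "i div M < 0" using False M_gt_1 by (simp add: pos_imp_zdiv_neg_iff)
    ultimately show ?thesis using N3 by (auto simp: gap_def)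
  qed

  \<comment> \<open>A gap is attached to the gap of the preceding layer that contains it; the
    topmost gaps form a chain running rightwards from \<open>r\<close>. The offset
    \<open>2 * N + 1\<close> in \<open>m\<close> ranks all other gaps after this chain.\<close>
  define tp where "tp q = (case fst q of 0 \<Rightarrow> (0, snd q - 1) | Suc l \<Rightarrow> (l, gap l (snd q)))" for q :: node
  define Q where "Q = {..n} \<times> {-N..N}"
  define r where "r = (0 :: nat, -N)"
  define m where "m q = (if fst q = 0 then nat (snd q + N) else nat (2 * N + 1) + fst q)" for q :: node

  have P_in_X: "i \<in> I l (gap l i)" "i + 1 \<in> I l (gap l i)" for l i
    using gap[of l i] by (auto simp: I_def)
  have gap_in_Q: "(l, gap l i) \<in> Q" if "(Suc l, i) \<in> P" for l i
    using n[OF that] N[OF that] gap_bound[of i l] by (auto simp: Q_def)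
  have XI: "x \<in> X (l, g)" if "x \<in> P" "i \<in> I l g" "x \<in> fw (Suc l, i) \<or> x \<in> stored (Suc l, i)" for x l g i
    using that by (auto simp: X_def)
  have up: "x \<in> X (tp (Suc l, g))"
    if x: "x \<in> P" "p = g \<or> p = g + 1" "x \<in> fw (Suc l, p) \<or> x \<in> stored (Suc l, p)" for x l g p
  proof -
    have "p \<in> I l (gap l g)" using x(2) P_in_X[of g l] by auto
    then show ?thesis using XI[OF x(1) _ x(3)] by (simp add: tp_def)
  qed

  define top where "top y \<longleftrightarrow> (\<forall>v. nxt v \<noteq> y)" for y
  have top_exists: "\<exists>y. top y \<and> x \<in> fw y" for x
  proof (induction "fst x" arbitrary: x rule: less_induct)
    case less
    show ?case
    proof (cases "top x")
      case True
      then show ?thesis using fw_self by blast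
    next
      case False
      then obtain v where v: "nxt v = x" by (auto simp: top_def)
      then have "fst v < fst x" using child_desc[OF nxt[of v]] by simp
      then obtain y where y: "top y" "v \<in> fw y" using less by blast
      then obtain i where "v = (nxt ^^ i) y" by (auto simp: fw_def)
      then have "x = (nxt ^^ Suc i) y" using v by simp
      then have "x \<in> fw y" unfolding fw_def by (rule range_eqI)
      then show ?thesis using y by blast
    qed
  qed
  have "inj nxt"
  proof (rule injI)
    fix u v assume "nxt u = nxt v"
    then show "u = v" using nxt[of u] nxt[of v] by (auto simp: child_def prod_eq_iff)
  qed
  have top_le: "y = c" if "top y" "(nxt ^^ a) y = (nxt ^^ b) c" "a \<le> b" for y c a b
  proof -
    have "(nxt ^^ b) c = (nxt ^^ a) ((nxt ^^ (b - a)) c)"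
      using that(3) by (metis comp_apply funpow_add le_add_diff_inverse)
    then have "y = (nxt ^^ (b - a)) c"
      using that(2) inj_fn[OF \<open>inj nxt\<close>, of a] by (simp add: inj_eq)
    then show ?thesis using that(1) unfolding top_def by (cases "b - a") (simp, metis comp_apply funpow.simps(2))
  qed
  have top_unique: "y = c" if y: "top y" "x \<in> fw y" and c: "top c" "x \<in> fw c" for x y c
  proof -
    obtain a where a: "x = (nxt ^^ a) y" using y(2) unfolding fw_def by blast
    obtain b where b: "x = (nxt ^^ b) c" using c(2) unfolding fw_def by blast
    show ?thesis
      using top_le[OF y(1), of a b c] top_le[OF c(1), of b a y] a b by (metis nat_le_linear)
  qed
  have top_0: "top (0, j)" for j
    unfolding top_def using nxt child_desc by (metis fst_conv not_less_zero)

  \<comment> \<open>The topmost bag \<open>z\<close> of \<open>x\<close> is the gap where the path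
    through \<open>x\<close> starts. A position \<open>i\<close> whose bag part contains
    \<open>x\<close> remembers \<open>x\<close>, or continues the path of its parent
    \<open>(l, p)\<close>, or starts the path of \<open>x\<close>. In the first two cases
    \<open>x\<close> passes on to \<open>tp q\<close> unless \<open>q\<close> is \<open>z\<close>;
    in the third \<open>q\<close> is \<open>z\<close>.\<close>
  have connected: "\<exists>z. \<forall>q\<in>Q. x \<in> X q \<longrightarrow> q \<noteq> z \<longrightarrow> q \<noteq> r \<and> x \<in> X (tp q)" if xP: "x \<in> P" for x
  proof -
    obtain y where y: "top y" "x \<in> fw y" using top_exists by blast
    define z where "z = (case fst y of 0 \<Rightarrow> (0, snd y - 1) | Suc l \<Rightarrow> (l, gap l (snd y)))"
    have "q \<noteq> r \<and> x \<in> X (tp q)" if "q \<in> Q" and xq: "x \<in> X q" and qz: "q \<noteq> z" for q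
    proof -
      obtain l g where q: "q = (l, g)" by fastforce
      obtain i where i: "i \<in> I l g" and x: "x \<in> fw (Suc l, i) \<or> x \<in> stored (Suc l, i)"
        using xq by (auto simp: X_def q)
      define p where "p = i div M"
      have p: "p = g \<or> p = g + 1" using I_div[OF i] by (simp add: p_def)
      have cp: "child (l, p) (Suc l, i)" by (simp add: child_def p_def)
      have step: ?thesis if "x \<in> fw (l, p) \<or> x \<in> stored (l, p)" "l = Suc l'" for l'
        using up[OF xP p, of l'] that by (simp add: q r_def)
      \<comment> \<open>This excludes that \<open>x\<close> is the parent \<open>(l, p)\<close> with
        \<open>l = 0\<close>, beyond which there is no earlier layer to climb to.\<close>
      have "0 < fst x" using xP pos by (auto simp: P_def)
      consider "x \<in> stored (Suc l, i)" | "x \<in> fw (Suc l, i)" "nxt (l, p) = (Suc l, i)"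
        | "x \<in> fw (Suc l, i)" "nxt (l, p) \<noteq> (Suc l, i)" using x by blast
      then show ?thesis
      proof cases
        case 1
        then have *: "x = (l, p) \<or> x \<in> stored (l, p)" using stored_child[OF cp] by blast
        then obtain l' where "l = Suc l'"
          using \<open>0 < fst x\<close> stored_0[of "(l, p)"] by (cases l) auto
        then show ?thesis using step * fw_self by blast
      next
        case 2
        then have xp: "x \<in> fw (l, p)" using fw_nxt[of x "(l, p)"] by simp
        show ?thesis
        proof (cases l)
          case 0
          then have "y = (0, p)" using top_unique[OF y top_0] xp by simp
          then have "z = (0, p - 1)" by (simp add: z_def)
          then have pg: "p = g" using p qz q 0 by auto
          \<comment> \<open>The path starts at an ancestor of \<open>x\<close>, whose position is no
            larger in absolute value than that of \<open>x\<close>; this keeps \<open>q\<close> away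
            from the end \<open>-N\<close> of the chain.\<close>
          have "desc (0, g) x" using fw_desc[OF xp] 0 pg by simp
          then have "g = snd x div M ^ fst x" by (simp add: desc_def)
          moreover have "\<bar>snd x div M ^ fst x\<bar> \<le> \<bar>snd x\<bar>"
          proof -
            have M1: "1 \<le> M ^ fst x" using M_gt_1 by simp
            show ?thesis
            proof (cases "snd x \<ge> 0")
              case True
              then show ?thesis
                using zdiv_mono2[of "snd x" 1 "M ^ fst x"] M1 by (simp add: pos_imp_zdiv_nonneg_iff)
            next
              case False
              moreover have "snd x div M ^ fst x < 0" using False M1 by (simp add: pos_imp_zdiv_neg_iff)
              ultimately show ?thesis
                using zdiv_mono2_neg[of "snd x" 1 "M ^ fst x"] M1 by simp
            qed
          qed
          ultimately have "\<bar>g\<bar> < N" using N[OF xP] by linarith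
          then have "q \<noteq> r" by (auto simp: q r_def)
          moreover have "i \<in> I 0 (g - 1)"
            using 2(2) nxt_eq[of 0 g] nx_le[of "g - 1" g 0] 0 pg by (simp add: I_def)
          then have "x \<in> X (0, g - 1)" using XI[OF xP, of i 0 "g - 1"] 2 0 by simp
          ultimately show ?thesis by (simp add: q tp_def 0)
        next
          case (Suc l')
          then show ?thesis using step xp by blast
        qed
      next
        case 3
        have "top (Suc l, i)"
          unfolding top_def
        proof (intro allI notI)
          fix v assume "nxt v = (Suc l, i)"
          moreover from this have "v = (l, p)" using nxt[of v] by (simp add: child_def p_def prod_eq_iff)
          ultimately show False using 3 by simp
        qed
        then have "y = (Suc l, i)" using top_unique[OF y] 3 by blast
        then have z: "z = (l, gap l i)" by (simp add: z_def)
        \<comment> \<open>The right end of a gap continues a path, which \<open>i\<close> does not;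
          so \<open>i\<close> lies in no other gap.\<close>
        have "i \<noteq> nx l (g + 1)"
          using 3(2) nxt_eq[of l "g + 1"] nx_div[of l "g + 1"] by (auto simp: p_def)
        then have "g = gap l i" using i by (intro gap_unique) (auto simp: I_def)
        then show ?thesis using z qz q by simp
      qed
    qed
    then show ?thesis by blast
  qed

  define X' where "X' q = {v \<in> verts G. f v \<in> X q}" for q
  show ?thesis
  proof (rule treewidth_le_parent_tree[where Q = Q and r = r and par = tp and m = m and X = X'])
    show "finite Q" by (simp add: Q_def)
    show "r \<in> Q" using N3 by (simp add: Q_def r_def)
    show "tp q \<in> Q \<and> m (tp q) < m q" if q: "q \<in> Q - {r}" for q
    proof (cases "fst q")
      case 0
      then show ?thesis using q by (auto simp: Q_def r_def tp_def m_def)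
    next
      case (Suc l)
      then have "-N \<le> gap l (snd q) \<and> gap l (snd q) \<le> N"
        using q by (intro gap_bound) (auto simp: Q_def)
      then show ?thesis using q Suc by (auto simp: Q_def tp_def m_def)
    qed
    show "X' q \<subseteq> verts G \<and> card (X' q) \<le> 2 * nat M * (K + s) + 1" if "q \<in> Q" for q
    proof
      show "X' q \<subseteq> verts G" by (auto simp: X'_def)
      have "card (X' q) = card (f ` X' q)"
        using f by (intro card_image[symmetric]) (auto simp: X'_def intro: inj_on_subset)
      also have "\<dots> \<le> card (X q)"
        using finP by (intro card_mono) (auto simp: X'_def X_def)
      finally show "card (X' q) \<le> 2 * nat M * (K + s) + 1" using X_card[of q] by simp
    qed
    show "\<exists>q\<in>Q. v \<in> X' q" if v: "v \<in> verts G" for v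
    proof -
      obtain l i where li: "f v = (Suc l, i)" using pos[OF v] by (metis gr0_conv_Suc prod.collapse)
      have P: "f v \<in> P" using v by (simp add: P_def)
      have "f v \<in> X (l, gap l i)" using XI[OF P P_in_X(1)] fw_self li by metis
      then show ?thesis using gap_in_Q[of l i] P li v by (auto simp: X'_def)
    qed
    show "\<exists>q\<in>Q. u \<in> X' q \<and> v \<in> X' q" if uv: "u \<in> verts G" "v \<in> verts G" "adj G u v" for u v
    proof -
      \<comment> \<open>The gap of \<open>f v\<close> serves for both ends: a right neighbour is
        still inside the closed interval, and an upper neighbour is remembered by
        \<open>f v\<close>.\<close>
      have main: "\<exists>q\<in>Q. f u \<in> X q \<and> f v \<in> X q"
        if v: "u \<in> verts G" "v \<in> verts G" and c: "fst (f u) = fst (f v) \<and> snd (f u) = snd (f v) + 1 \<or> f u \<in> up (f v)" for u v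
      proof -
        obtain l i where li: "f v = (Suc l, i)" using pos[OF v(2)] by (metis gr0_conv_Suc prod.collapse)
        have P: "f v \<in> P" "f u \<in> P" using v by (auto simp: P_def)
        have "f v \<in> X (l, gap l i)" using XI[OF P(1) P_in_X(1)] fw_self li by metis
        moreover have "f u \<in> X (l, gap l i)"
          using c
        proof
          assume "f u \<in> up (f v)"
          then have "f u \<in> stored (Suc l, i)" using up_cand[of "f v"] cand_stored[of "f v"] li by auto
          then show ?thesis using XI[OF P(2) P_in_X(1)] by blast
        next
          assume "fst (f u) = fst (f v) \<and> snd (f u) = snd (f v) + 1"
          then have "f u = (Suc l, i + 1)" using li by (simp add: prod_eq_iff)
          then show ?thesis using XI[OF P(2) P_in_X(2)] fw_self by metis
        qed
        ultimately show ?thesis using gap_in_Q[of l i] P li by auto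
      qed
      have "ladj (f u) (f v)" using uv fadj by simp
      then have "(fst (f u) = fst (f v) \<and> snd (f u) = snd (f v) + 1 \<or> f u \<in> up (f v)) \<or>
          (fst (f v) = fst (f u) \<and> snd (f v) = snd (f u) + 1 \<or> f v \<in> up (f u))"
        unfolding ladj_def by linarith
      then show ?thesis using main[of u v] main[of v u] uv(1,2) by (auto simp: X'_def)
    qed
    show "\<exists>z. \<forall>q\<in>Q. v \<in> X' q \<longrightarrow> q \<noteq> z \<longrightarrow> q \<noteq> r \<and> v \<in> X' (tp q)" if v: "v \<in> verts G" for v
      using connected[of "f v"] v by (simp add: X'_def P_def)
  qed
qed

subsection \<open>The graph class\<close>

text \<open>Vertices start in layer 1, so that each layer in use is cut into gaps by paths from the
  preceding one.\<close>

definition layered_class :: "nat sgraph set" where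
  "layered_class = {G. wf_graph G \<and> (\<exists>f. inj_on f (verts G) \<and> (\<forall>v\<in>verts G. 0 < fst (f v)) \<and>
     (\<forall>u\<in>verts G. \<forall>v\<in>verts G. adj G u v \<longleftrightarrow> ladj (f u) (f v)))}"

lemma layered_classE:
  assumes "G \<in> layered_class"
  obtains f where "wf_graph G" "inj_on f (verts G)" "\<And>v. v \<in> verts G \<Longrightarrow> 0 < fst (f v)"
    "\<And>u v. \<lbrakk>u \<in> verts G; v \<in> verts G\<rbrakk> \<Longrightarrow> adj G u v \<longleftrightarrow> ladj (f u) (f v)"
proof -
  have wf: "wf_graph G" and "\<exists>f. inj_on f (verts G) \<and> (\<forall>v\<in>verts G. 0 < fst (f v)) \<and>
     (\<forall>u\<in>verts G. \<forall>v\<in>verts G. adj G u v \<longleftrightarrow> ladj (f u) (f v))"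
    using assms by (simp_all add: layered_class_def)
  then obtain f where f: "inj_on f (verts G)" "\<forall>v\<in>verts G. 0 < fst (f v)"
     "\<forall>u\<in>verts G. \<forall>v\<in>verts G. adj G u v \<longleftrightarrow> ladj (f u) (f v)" by metis
  show thesis by (rule that[of f]) (use wf f in auto)
qed

lemma layered_classI:
  assumes "wf_graph G" "inj_on f (verts G)" "\<And>v. v \<in> verts G \<Longrightarrow> 0 < fst (f v)"
    "\<And>u v. \<lbrakk>u \<in> verts G; v \<in> verts G\<rbrakk> \<Longrightarrow> adj G u v \<longleftrightarrow> ladj (f u) (f v)"
  shows "G \<in> layered_class"
  using assms unfolding layered_class_def by (intro CollectI conjI exI[of _ f]) simp_all

lemma layered_class_triangle_free: "G \<in> layered_class \<Longrightarrow> triangle_free G"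
  unfolding triangle_free_def by (erule layered_classE) (use no_triangle in blast)

lemma layered_class_iso_closed: "iso_closed layered_class"
  unfolding iso_closed_def
proof (intro ballI allI impI)
  fix G G' :: "nat sgraph" assume G: "G \<in> layered_class" and "wf_graph G' \<and> graph_iso G G'"
  then have wf: "wf_graph G'" and iso: "graph_iso G G'" by auto
  obtain h where h: "bij_betw h (verts G) (verts G')"
      and hadj: "\<And>u v. \<lbrakk>u \<in> verts G; v \<in> verts G\<rbrakk> \<Longrightarrow> adj G u v \<longleftrightarrow> adj G' (h u) (h v)"
    using iso unfolding graph_iso_def by metis
  obtain f where f: "inj_on f (verts G)" "\<And>v. v \<in> verts G \<Longrightarrow> 0 < fst (f v)"
    "\<And>u v. \<lbrakk>u \<in> verts G; v \<in> verts G\<rbrakk> \<Longrightarrow> adj G u v \<longleftrightarrow> ladj (f u) (f v)"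
    using layered_classE[OF G] by metis
  define g where "g = inv_into (verts G) h"
  have g: "bij_betw g (verts G') (verts G)" unfolding g_def using h by (rule bij_betw_inv_into)
  have gv: "g v \<in> verts G" "h (g v) = v" if "v \<in> verts G'" for v
    using that g h by (auto simp: g_def bij_betw_apply bij_betw_inv_into_right)
  show "G' \<in> layered_class"
  proof (rule layered_classI[OF wf])
    show "inj_on (f \<circ> g) (verts G')"
      using g f(1) by (auto simp: bij_betw_def intro: comp_inj_on)
    show "0 < fst ((f \<circ> g) v)" if "v \<in> verts G'" for v using f(2) gv(1)[OF that] by simp
    show "adj G' u v \<longleftrightarrow> ladj ((f \<circ> g) u) ((f \<circ> g) v)" if "u \<in> verts G'" "v \<in> verts G'" for u v
      using f(3)[of "g u" "g v"] hadj[of "g u" "g v"] gv[OF that(1)] gv[OF that(2)] by simp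
  qed
qed

lemma layered_class_hereditary: "hereditary layered_class"
  unfolding hereditary_def
proof (intro ballI allI impI)
  fix G :: "nat sgraph" and S assume G: "G \<in> layered_class" and S: "S \<subseteq> verts G"
  obtain f where wf: "wf_graph G" and f: "inj_on f (verts G)" "\<And>v. v \<in> verts G \<Longrightarrow> 0 < fst (f v)"
    "\<And>u v. \<lbrakk>u \<in> verts G; v \<in> verts G\<rbrakk> \<Longrightarrow> adj G u v \<longleftrightarrow> ladj (f u) (f v)"
    using layered_classE[OF G] by metis
  have V: "verts (induced G S) = S" using S by (auto simp: induced_def)
  have "wf_graph (induced G S)"
    unfolding wf_graph_def V
  proof (intro conjI ballI)
    show "finite S" using S wf by (auto simp: wf_graph_def intro: finite_subset)
    fix e assume "e \<in> edges (induced G S)"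
    then have e: "e \<in> edges G" "e \<subseteq> S" by (auto simp: induced_def)
    obtain u v where "e = {u, v}" "u \<noteq> v" using wf_graph_edgeE[OF wf e(1)] by metis
    then show "\<exists>u v. e = {u, v} \<and> u \<noteq> v \<and> u \<in> S \<and> v \<in> S" using e(2) by blast
  qed
  then show "induced G S \<in> layered_class"
  proof (rule layered_classI)
    show "inj_on f (verts (induced G S))" unfolding V using f(1) S by (rule inj_on_subset)
    show "0 < fst (f v)" if "v \<in> verts (induced G S)" for v using f(2) that S V by auto
    show "adj (induced G S) u v \<longleftrightarrow> ladj (f u) (f v)"
      if "u \<in> verts (induced G S)" "v \<in> verts (induced G S)" for u v
      using f(3)[of u v] that S by (auto simp: V adj_def) (auto simp: induced_def)
  qed
qed

lemma layered_class_weakly_sparse: "weakly_sparse layered_class"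
  unfolding weakly_sparse_def
proof (intro exI[of _ "s + 3"] ballI notI)
  fix G assume G: "G \<in> layered_class" and "has_Kss (s + 3) G"
  then obtain A B where AB: "A \<subseteq> verts G" "B \<subseteq> verts G" "card A = s + 3" "card B = s + 3" "finite A" "finite B"
      "\<And>a b. \<lbrakk>a \<in> A; b \<in> B\<rbrakk> \<Longrightarrow> adj G a b"
    unfolding has_Kss_def by metis
  obtain f where f: "inj_on f (verts G)"
    "\<And>u v. \<lbrakk>u \<in> verts G; v \<in> verts G\<rbrakk> \<Longrightarrow> adj G u v \<longleftrightarrow> ladj (f u) (f v)"
    using layered_classE[OF G] by metis
  show False
  proof (rule no_biclique)
    show "card (f ` A) = s + 3" "card (f ` B) = s + 3"
      using AB card_image[OF inj_on_subset[OF f(1)]] by auto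
    show "ladj a b" if "a \<in> f ` A" "b \<in> f ` B" for a b
      using that AB f(2) by blast
  qed (use AB in auto)
qed

section \<open>Unbounded treewidth\<close>

lemma store_below:
  "\<exists>w. fst w = fst x + d \<and> desc x w \<and> x \<in> insert w (stored w)"
proof (induction d)
  case 0
  then show ?case by (intro exI[of _ x]) simp
next
  case (Suc d)
  then obtain w where w: "fst w = fst x + d" "desc x w" "{x} \<subseteq> insert w (stored w)"
    by (metis empty_subsetI insert_subset)
  obtain c where c: "child w c" "{x} \<subseteq> stored c"
    using child_exists[OF w(3), of "{}"] two_le_s by auto
  then show ?case
    using w child_desc[OF c(1)] desc_trans[OF w(2), of c] by (intro exI[of _ c]) (auto simp: child_def)
qed

text \<open>Remember \<open>x\<close> down to the layer before \<open>l\<close>, then take a child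
  with candidate set \<open>{x}\<close>, which is clean because no node is its own
  candidate.\<close>

lemma nbr_below:
  assumes "fst x < l"
  shows "\<exists>w. fst w = l \<and> desc x w \<and> ladj x w"
proof -
  obtain d where d: "l = Suc (fst x + d)" using assms less_iff_Suc_add by auto
  obtain w where w: "fst w = fst x + d" "desc x w" "{x} \<subseteq> insert w (stored w)"
    using store_below[of x d] by (metis empty_subsetI insert_subset)
  obtain c where c: "child w c" "cand c = {x}"
    using child_exists[OF w(3), of "{x}"] two_le_s by auto
  have "x \<notin> cand x" using cand_stored[of x] stored_desc[of x x] by auto
  then have "x \<in> up c" using c(2) by (simp add: up_def clean_def)
  then show ?thesis
    using d w c child_desc[OF c(1)] desc_trans[OF w(2), of c]
    by (intro exI[of _ c]) (auto simp: ladj_def child_def)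
qed

text \<open>The layers from 1 to \<open>k + 2\<close>, cut to a common width, are the branch sets of
  a clique minor that is too large for width \<open>k\<close>.\<close>

lemma layered_class_unbounded: "\<not> bounded_tw layered_class"
proof
  assume "bounded_tw layered_class"
  then obtain k where k: "\<And>G. G \<in> layered_class \<Longrightarrow> treewidth_le G k" by (auto simp: bounded_tw_def)
  define n where "n = k + 2"
  \<comment> \<open>Descendants of \<open>(i, 0)\<close> in layer \<open>j\<close> have positions
    below \<open>M ^ (j - i)\<close>, so the width \<open>M ^ n\<close> retains the neighbours that
    join the layers.\<close>
  define V :: "node set" where "V = {1..n} \<times> {0..<M ^ n}"
  have "finite V" by (simp add: V_def)
  then obtain e :: "node \<Rightarrow> nat" where e: "inj_on e V"
    using finite_imp_inj_to_nat_seg by metis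
  define G :: "nat sgraph" where
    "G = \<lparr>verts = e ` V, edges = {{e x, e y} | x y. x \<in> V \<and> y \<in> V \<and> ladj x y}\<rparr>"
  have adjG: "adj G (e x) (e y) \<longleftrightarrow> ladj x y" if "x \<in> V" "y \<in> V" for x y
  proof
    assume "adj G (e x) (e y)"
    then obtain a b where ab: "{e x, e y} = {e a, e b}" "a \<in> V" "b \<in> V" "ladj a b"
      by (auto simp: adj_def G_def)
    then have "x = a \<and> y = b \<or> x = b \<and> y = a"
      using e that by (auto simp: doubleton_eq_iff inj_on_eq_iff)
    then show "ladj x y" using ab(4) ladj_commute[of a b] by auto
  next
    assume "ladj x y"
    then show "adj G (e x) (e y)" using that unfolding adj_def G_def by (simp del: split_paired_Ex) blast
  qed
  have wf: "wf_graph G"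
    unfolding wf_graph_def
  proof (intro conjI ballI)
    show "finite (verts G)" using \<open>finite V\<close> by (simp add: G_def)
    fix a assume "a \<in> edges G"
    then obtain x y where xy: "a = {e x, e y}" "x \<in> V" "y \<in> V" "ladj x y" by (auto simp: G_def)
    then have "x \<noteq> y" using ladj_irrefl by blast
    then have "e x \<noteq> e y" using e xy by (simp add: inj_on_eq_iff)
    then show "\<exists>u v. a = {u, v} \<and> u \<noteq> v \<and> u \<in> verts G \<and> v \<in> verts G"
      using xy by (intro exI[of _ "e x"] exI[of _ "e y"]) (simp add: G_def)
  qed
  have "G \<in> layered_class"
  proof (rule layered_classI[OF wf])
    have iv: "inv_into V e u \<in> V" "e (inv_into V e u) = u" if "u \<in> verts G" for u
      using that by (auto simp: G_def inv_into_into f_inv_into_f)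
    show "inj_on (inv_into V e) (verts G)" by (simp add: G_def inj_on_inv_into)
    show "0 < fst (inv_into V e v)" if "v \<in> verts G" for v
      using iv(1)[OF that] by (auto simp: V_def)
    show "adj G u v \<longleftrightarrow> ladj (inv_into V e u) (inv_into V e v)" if "u \<in> verts G" "v \<in> verts G" for u v
      using adjG[OF iv(1)[OF that(1)] iv(1)[OF that(2)]] iv(2) that by simp
  qed
  then have tw: "treewidth_le G k" by (rule k)
  define L where "L i = e ` ({i} \<times> {0..<M ^ n})" for i :: nat
  have Mn: "0 < M ^ n" using M_gt_1 by simp
  have sub: "{i} \<times> {0..<M ^ n} \<subseteq> V" if "i \<in> {1..n}" for i using that by (auto simp: V_def)
  have touch: "\<exists>u\<in>L i. \<exists>v\<in>L j. adj G u v" if i: "i \<in> {1..n}" and j: "j \<in> {1..n}" and "i < j" for i j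
  proof -
    obtain w where w: "fst w = j" "desc (i, 0) w" "ladj (i, 0) w"
      using nbr_below[of "(i, 0)" j] \<open>i < j\<close> by auto
    have "0 < M ^ (j - i)" using M_gt_1 by simp
    moreover have "snd w div M ^ (j - i) = 0" using w(1,2) by (simp add: desc_def)
    ultimately have "0 \<le> snd w" "snd w < M ^ (j - i)"
      unfolding zdiv_eq_0_iff by linarith+
    moreover have "M ^ (j - i) \<le> M ^ n" using M_gt_1 j by (intro power_increasing) auto
    ultimately have wj: "w \<in> {j} \<times> {0..<M ^ n}" using w(1) by (auto simp: mem_Times_iff)
    have i0: "(i, 0) \<in> {i} \<times> {0..<M ^ n}" using Mn by simp
    have "adj G (e (i, 0)) (e w)"
      using adjG[of "(i, 0)" w] sub[OF i] sub[OF j] i0 wj w(3) by blast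
    then show ?thesis unfolding L_def using i0 wj by blast
  qed
  have "card {1..n} \<le> k + 1"
  proof (rule treewidth_ge_clique_minor[OF tw wf, where L = L])
    fix i assume i: "i \<in> {1..n}"
    let ?R = "\<lambda>x y. x \<in> L i \<and> y \<in> L i \<and> adj G x y"
    have from_0: "?R\<^sup>*\<^sup>* (e (i, 0)) (e (i, int a))" if "int a < M ^ n" for a
      using that
    proof (induction a)
      case (Suc a)
      have "(i, int a) \<in> {i} \<times> {0..<M ^ n}" "(i, int (Suc a)) \<in> {i} \<times> {0..<M ^ n}"
        using Suc.prems by auto
      moreover have "ladj (i, int a) (i, int (Suc a))" by (simp add: ladj_def)
      ultimately have "?R (e (i, int a)) (e (i, int (Suc a)))"
        using adjG[of "(i, int a)" "(i, int (Suc a))"] sub[OF i] unfolding L_def by blast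
      moreover have "?R\<^sup>*\<^sup>* (e (i, 0)) (e (i, int a))" using Suc by simp
      ultimately show ?case by (rule rtranclp.rtrancl_into_rtrancl[rotated])
    qed simp
    have from_0': "?R\<^sup>*\<^sup>* (e (i, 0)) u" if u: "u \<in> L i" for u
    proof -
      obtain b where "u = e (i, b)" "0 \<le> b" "b < M ^ n" using u by (auto simp: L_def)
      then show ?thesis using from_0[of "nat b"] by simp
    qed
    have sym: "symp ?R" by (auto simp: symp_def adj_commute)
    have "?R\<^sup>*\<^sup>* u v" if "u \<in> L i" "v \<in> L i" for u v
      using sympD[OF symp_rtranclp[OF sym] from_0'[OF that(1)]] from_0'[OF that(2)] by (rule rtranclp_trans)
    then have "connected_on G (L i)" by (simp add: connected_on_def)
    moreover have "L i \<subseteq> verts G" using sub[OF i] by (auto simp: L_def G_def)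
    moreover have "L i \<noteq> {}" using Mn by (auto simp: L_def)
    ultimately show "L i \<subseteq> verts G \<and> L i \<noteq> {} \<and> connected_on G (L i)" by simp
  next
    fix i j assume ij: "i \<in> {1..n}" "j \<in> {1..n}" "i \<noteq> j"
    show "L i \<inter> L j = {}"
      unfolding L_def using inj_on_image_Int[OF e sub[OF ij(1)] sub[OF ij(2)]] ij(3) by auto
    show "\<exists>u\<in>L i. \<exists>v\<in>L j. adj G u v"
      using touch[of i j] touch[of j i] ij adj_commute by (metis linorder_neqE_nat)
  qed
  then show False by (simp add: n_def)
qed

section \<open>Bounded treewidth of the H-free part\<close>

lemma layered_class_H_free_bounded:
  fixes H :: "'b sgraph"
  assumes H: "wf_graph H" "triangle_free H" "treewidth_le H t" and t: "t + 2 \<le> s"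
  shows "bounded_tw {G \<in> layered_class. H_free H G}"
proof -
  obtain K where K: "\<And>P n u. K \<le> thick P n u \<Longrightarrow> \<exists>f. embeds H P f (verts H)"
    using thick_embeds[OF H t] by blast
  have "treewidth_le G (2 * nat M * (K + s))" if G: "G \<in> layered_class" and free: "H_free H G" for G
  proof -
    obtain f where wf: "wf_graph G" and f: "inj_on f (verts G)" "\<And>v. v \<in> verts G \<Longrightarrow> 0 < fst (f v)"
      and fadj: "\<And>u v. \<lbrakk>u \<in> verts G; v \<in> verts G\<rbrakk> \<Longrightarrow> adj G u v \<longleftrightarrow> ladj (f u) (f v)"
      using layered_classE[OF G] by metis
    let ?P = "f ` verts G"
    have no_emb: "\<not> embeds H ?P g (verts H)" for g
    proof
      assume g: "embeds H ?P g (verts H)"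
      define h where "h = inv_into (verts G) f \<circ> g"
      have gP: "g x \<in> ?P" if "x \<in> verts H" for x using g that by (auto simp: embeds_def)
      have hG: "h x \<in> verts G" "f (h x) = g x" if "x \<in> verts H" for x
        using gP[OF that] by (simp_all add: h_def inv_into_into f_inv_into_f)
      let ?S = "h ` verts H"
      have S: "?S \<subseteq> verts G" using hG by auto
      have "inj_on h (verts H)"
      proof (rule inj_onI)
        fix x y assume "x \<in> verts H" "y \<in> verts H" "h x = h y"
        moreover from this have "g x = g y" using hG(2) by metis
        ultimately show "x = y" using g by (auto simp: embeds_def inj_on_def)
      qed
      moreover have "verts (induced G ?S) = ?S" using S by (auto simp: induced_def)
      ultimately have "bij_betw h (verts H) (verts (induced G ?S))" by (simp add: bij_betw_def)
      moreover have "adj H x y \<longleftrightarrow> adj (induced G ?S) (h x) (h y)" if "x \<in> verts H" "y \<in> verts H" for x y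
      proof -
        have "adj H x y \<longleftrightarrow> ladj (g x) (g y)" using g that by (auto simp: embeds_def)
        also have "\<dots> \<longleftrightarrow> adj G (h x) (h y)" using fadj hG that by simp
        also have "\<dots> \<longleftrightarrow> adj (induced G ?S) (h x) (h y)"
          using that by (simp add: adj_def induced_def)
        finally show ?thesis .
      qed
      ultimately have "graph_iso H (induced G ?S)" unfolding graph_iso_def by blast
      then show False using free S unfolding H_free_def by blast
    qed
    have "finite (fst ` ?P)" using wf by (simp add: wf_graph_def)
    then obtain n where n: "\<And>x. x \<in> ?P \<Longrightarrow> fst x < n"
      unfolding finite_nat_set_iff_bounded by blast
    obtain nxt where nxt: "\<And>u. child u (nxt u)"
        "\<And>u. card (?P \<inter> range (\<lambda>i. (nxt ^^ i) u)) \<le> thick ?P n u"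
      using thin_paths[OF n] by metis
    have thick: "thick ?P n u \<le> K" for u using K[of ?P n u] no_emb by (meson nat_le_linear)
    have "card (?P \<inter> range (\<lambda>i. (nxt ^^ i) u)) \<le> K" for u
      using nxt(2)[of u] thick[of u] by (rule order_trans)
    then show ?thesis
      by (intro treewidth_thin_paths[OF wf f(1) _ _ nxt(1)]) (use f(2) fadj in auto)
  qed
  then show ?thesis unfolding bounded_tw_def by blast
qed

end

section \<open>Choice of the parameters and conclusion\<close>

text \<open>The codes are all pairs of a slot and a mask, listed by \<open>e\<close>. The children
  of a node come in \<open>m\<close> pairs, whose even member carries a code and whose odd member
  has its mask emptied; hence \<open>M\<close> is \<open>2 * m\<close>.\<close>

lemma layered_graph_exists:
  assumes "2 \<le> s"
  shows "\<exists>M slot mask. layered_graph s M slot mask"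
proof -
  define C where "C = {..<s} \<times> Pow {..<s}"
  have fin: "finite C" by (simp add: C_def)
  obtain e where e: "bij_betw e {0..<card C} C" using ex_bij_betw_nat_finite[OF fin] by metis
  define m where "m = int (card C)"
  have "(0, {}) \<in> C" using assms by (simp add: C_def)
  then have "C \<noteq> {}" by blast
  then have m: "0 < m" using fin by (simp add: m_def card_gt_0_iff)
  define code where "code j = e (nat (j mod (2 * m) div 2))" for j :: int
  have code_mem: "code j \<in> C" for j
  proof -
    have "0 \<le> j mod (2 * m)" "j mod (2 * m) < 2 * m" using m by simp_all
    then have "0 \<le> j mod (2 * m) div 2" "j mod (2 * m) div 2 < m" by linarith+
    then have "nat (j mod (2 * m) div 2) \<in> {0..<card C}" by (simp add: m_def)
    then show ?thesis unfolding code_def using e by (rule bij_betw_apply[rotated])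
  qed
  have "layered_graph s (2 * m) (\<lambda>j. fst (code j)) (\<lambda>j. if odd j then {} else snd (code j))"
  proof
    fix q Z and p :: int assume q: "q < s" "Z \<subseteq> {..<s}"
    then have "(q, Z) \<in> C" by (simp add: C_def)
    then have "(q, Z) \<in> e ` {0..<card C}" using e by (auto simp: bij_betw_def)
    then obtain r where r: "r < card C" "e r = (q, Z)" by auto
    define j where "j = p * (2 * m) + 2 * int r"
    have rm: "2 * int r < 2 * m" using r(1) by (simp add: m_def)
    have "j div (2 * m) = p" "j mod (2 * m) = 2 * int r"
      using rm m by (simp_all add: j_def)
    moreover have "even j" by (simp add: j_def)
    ultimately show "\<exists>j. j div (2 * m) = p \<and> even j \<and> fst (code j) = q \<and>
        (if odd j then {} else snd (code j)) = Z"
      using r by (intro exI[of _ j]) (simp add: code_def)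
  qed (use assms m code_mem in \<open>auto simp: C_def mem_Times_iff\<close>)
  then show ?thesis by blast
qed

theorem theorem1p3:
  fixes t :: nat
  assumes "t \<ge> 1"
  shows "\<exists>C :: nat sgraph set.
           (\<forall>G\<in>C. wf_graph G \<and> triangle_free G) \<and>
           iso_closed C \<and> hereditary C \<and> weakly_sparse C \<and>
           \<not> bounded_tw C \<and>
           (\<forall>H :: nat sgraph. wf_graph H \<and> triangle_free H \<and> treewidth_le H t \<longrightarrow>
               bounded_tw {G\<in>C. H_free H G})"
proof -
  obtain M slot mask where "layered_graph (t + 2) M slot mask"
    using layered_graph_exists[of "t + 2"] by auto
  then interpret layered_graph "t + 2" M slot mask .
  have "wf_graph G" if "G \<in> layered_class" for G using layered_classE[OF that] by metis
  moreover have "bounded_tw {G \<in> layered_class. H_free H G}"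
    if "wf_graph H" "triangle_free H" "treewidth_le H t" for H :: "nat sgraph"
    using that by (rule layered_class_H_free_bounded) simp
  ultimately show ?thesis
    using layered_class_triangle_free layered_class_iso_closed layered_class_hereditary
      layered_class_weakly_sparse layered_class_unbounded
    by (intro exI[of _ layered_class]) simp
qed

end
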